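(* Let $\mathcal C$ be a tensor category and let $A\in\mathcal C$ be an algebra such that $\mathcal C_A$ is an exact left $\mathcal C$-module category. There is an isomorphism of $A$-bimodules $$A\simeq\oint_{M\in\mathcal C_A}{}^*M\otimes M.$$
   Context: $k$ is a field; all categories are finite abelian $k$-linear; functors are additive and $k$-linear (in each variable). A tensor category $\mathcal C$ is a rigid monoidal category (with $k$-bilinear tensor product) with simple unit $\mathbf 1$; associativity constraints are suppressed. For $X\in\mathcal C$: $X^*$ is the dual with $\mathrm{ev}_X:X^*\otimes X\to\mathbf 1$, $\mathrm{coev}_X:\mathbf 1\to X\otimes X^*$; ${}^*X$ is the dual with $\mathrm{ev}_X:X\otimes{}^*X\to\mathbf 1$, $\mathrm{coev}_X:\mathbf 1\to{}^*X\otimes X$; ${}^*(X^* )$ is identified with $X$; $\phi^l_{X,Y}:{}^*(X\otimes Y)\to{}^*Y\otimes{}^*X$ is the canonical isomorphism. $\mathcal C_A$ is the category of right $A$-modules in $\mathcal C$, a left $\mathcal C$-module category via $X\triangleright M=X\otimes M$; it is exact if $P\triangleright M$ is projective for every projective $P\in\mathcal C$ and every $M\in\mathcal C_A$. If $M\in\mathcal C_A$ has action $\rho_M$, then ${}^*M$ is a left $A$-module with action $(\mathrm{id}\otimes\mathrm{ev}_M)(\mathrm{id}\otimes\rho_M\otimes\mathrm{id})(\mathrm{coev}_M\otimes\mathrm{id}_{A\otimes{}^*M})$, so ${}^*M\otimes N$ is an $A$-bimodule for $M,N\in\mathcal C_A$. For a functor $S:\mathcal M^{op}\times\mathcal M\to\mathcal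 A$ on a left $\mathcal C$-module category, a pre-balancing is a natural isomorphism $\gamma^X_{M,N}:S(M,X\triangleright N)\to S(X^*\triangleright M,N)$. The module end $\oint_{M\in\mathcal M}(S,\gamma)$ is an object $E\in\mathcal A$ with a dinatural $\pi_M:E\to S(M,M)$ satisfying, for all $X,M$, $S(\mathrm{ev}_X\triangleright\mathrm{id}_M,\mathrm{id}_M)\pi_M=S(m_{X^*,X,M},\mathrm{id}_M)\gamma^X_{X\triangleright M,M}\pi_{X\triangleright M}$ ($m$ the module associativity), and universal: any $\tilde E$ with dinatural $\xi_M:\tilde E\to S(M,M)$ satisfying the same equation factors as $\xi_M=\pi_M\circ h$ for a unique $h$. In the claim the module end is that of the functor $(\mathcal C_A)^{op}\times\mathcal C_A\to{}_A\mathcal C_A$ (the category of $A$-bimodules in $\mathcal C$), $(\overline M,N)\mapsto{}^*M\otimes N$, with pre-balancing $\gamma^X_{M,N}=(\phi^l_{X^*,M})^{-1}\otimes\mathrm{id}_N:{}^*M\otimes X\otimes N\to{}^*(X^*\otimes M)\otimes N$. *)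

theory Defs
  imports "HOL-Algebra.Module"
begin

section \<open>Linear categories\<close>

text \<open>
  A hom-space is a module record over the ground field; its multiplicative fields are never used.
  The hom-spaces of a category need not be disjoint (for module categories they are not: one arrow
  of the ambient category can be a module map for several module structures). Composition is only
  meaningful for composable arrows.
\<close>

record ('k, 'o, 'm) lincat =
  Obj :: "'o set"
  Hom :: "'o \<Rightarrow> 'o \<Rightarrow> ('k, 'm) module"
  Idm :: "'o \<Rightarrow> 'm"
  Comp :: "'m \<Rightarrow> 'm \<Rightarrow> 'm"  (infixr \<open>\<cdot>\<index>\<close> 55)

abbreviation Ar :: "('k, 'o, 'm, 'z) lincat_scheme \<Rightarrow> 'o \<Rightarrow> 'o \<Rightarrow> 'm set" where
  "Ar C X Y \<equiv> carrier (Hom C X Y)"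

locale linear_category = field k
  for k :: "'k ring" and C :: "('k, 'o, 'm, 'z) lincat_scheme" (structure) +
  assumes hom_module: "\<lbrakk>X \<in> Obj C; Y \<in> Obj C\<rbrakk> \<Longrightarrow> module k (Hom C X Y)"
    and id_arr: "X \<in> Obj C \<Longrightarrow> Idm C X \<in> Ar C X X"
    and comp_arr:
      "\<lbrakk>X \<in> Obj C; Y \<in> Obj C; Z \<in> Obj C; f \<in> Ar C X Y; g \<in> Ar C Y Z\<rbrakk> \<Longrightarrow> g \<cdot> f \<in> Ar C X Z"
    and comp_assoc:
      "\<lbrakk>W \<in> Obj C; X \<in> Obj C; Y \<in> Obj C; Z \<in> Obj C; f \<in> Ar C W X; g \<in> Ar C X Y; h \<in> Ar C Y Z\<rbrakk>
        \<Longrightarrow> (h \<cdot> g) \<cdot> f = h \<cdot> (g \<cdot> f)"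
    and id_comp: "\<lbrakk>X \<in> Obj C; Y \<in> Obj C; f \<in> Ar C X Y\<rbrakk> \<Longrightarrow> Idm C Y \<cdot> f = f"
    and comp_id: "\<lbrakk>X \<in> Obj C; Y \<in> Obj C; f \<in> Ar C X Y\<rbrakk> \<Longrightarrow> f \<cdot> Idm C X = f"
    and comp_add_right:
      "\<lbrakk>X \<in> Obj C; Y \<in> Obj C; Z \<in> Obj C; f \<in> Ar C X Y; f' \<in> Ar C X Y; g \<in> Ar C Y Z\<rbrakk>
        \<Longrightarrow> g \<cdot> (f \<oplus>\<^bsub>Hom C X Y\<^esub> f') = (g \<cdot> f) \<oplus>\<^bsub>Hom C X Z\<^esub> (g \<cdot> f')"
    and comp_add_left:
      "\<lbrakk>X \<in> Obj C; Y \<in> Obj C; Z \<in> Obj C; f \<in> Ar C X Y; g \<in> Ar C Y Z; g' \<in> Ar C Y Z\<rbrakk>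
        \<Longrightarrow> (g \<oplus>\<^bsub>Hom C Y Z\<^esub> g') \<cdot> f = (g \<cdot> f) \<oplus>\<^bsub>Hom C X Z\<^esub> (g' \<cdot> f)"
    and comp_smult_right:
      "\<lbrakk>X \<in> Obj C; Y \<in> Obj C; Z \<in> Obj C; a \<in> carrier k; f \<in> Ar C X Y; g \<in> Ar C Y Z\<rbrakk>
        \<Longrightarrow> g \<cdot> (a \<odot>\<^bsub>Hom C X Y\<^esub> f) = a \<odot>\<^bsub>Hom C X Z\<^esub> (g \<cdot> f)"
    and comp_smult_left:
      "\<lbrakk>X \<in> Obj C; Y \<in> Obj C; Z \<in> Obj C; a \<in> carrier k; f \<in> Ar C X Y; g \<in> Ar C Y Z\<rbrakk>
        \<Longrightarrow> (a \<odot>\<^bsub>Hom C Y Z\<^esub> g) \<cdot> f = a \<odot>\<^bsub>Hom C X Z\<^esub> (g \<cdot> f)"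

context
  fixes C :: "('k, 'o, 'm, 'z) lincat_scheme" (structure)
begin

definition inverse_arrows :: "'o \<Rightarrow> 'o \<Rightarrow> 'm \<Rightarrow> 'm \<Rightarrow> bool" where
  "inverse_arrows X Y f g \<longleftrightarrow>
     f \<in> Ar C X Y \<and> g \<in> Ar C Y X \<and> g \<cdot> f = Idm C X \<and> f \<cdot> g = Idm C Y"

definition iso_arrow :: "'o \<Rightarrow> 'o \<Rightarrow> 'm \<Rightarrow> bool" where
  "iso_arrow X Y f \<longleftrightarrow> (\<exists>g. inverse_arrows X Y f g)"

definition Inv :: "'o \<Rightarrow> 'o \<Rightarrow> 'm \<Rightarrow> 'm" where
  "Inv X Y f = (THE g. inverse_arrows X Y f g)"

definition isomorphic :: "'o \<Rightarrow> 'o \<Rightarrow> bool" where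
  "isomorphic X Y \<longleftrightarrow> (\<exists>f. iso_arrow X Y f)"

definition monic :: "'o \<Rightarrow> 'o \<Rightarrow> 'm \<Rightarrow> bool" where
  "monic X Y f \<longleftrightarrow> f \<in> Ar C X Y \<and>
     (\<forall>W \<in> Obj C. \<forall>g \<in> Ar C W X. \<forall>h \<in> Ar C W X. f \<cdot> g = f \<cdot> h \<longrightarrow> g = h)"

definition epic :: "'o \<Rightarrow> 'o \<Rightarrow> 'm \<Rightarrow> bool" where
  "epic X Y f \<longleftrightarrow> f \<in> Ar C X Y \<and>
     (\<forall>Z \<in> Obj C. \<forall>g \<in> Ar C Y Z. \<forall>h \<in> Ar C Y Z. g \<cdot> f = h \<cdot> f \<longrightarrow> g = h)"

definition zero_object :: "'o \<Rightarrow> bool" where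
  "zero_object Z \<longleftrightarrow> Z \<in> Obj C \<and>
     (\<forall>X \<in> Obj C. (\<exists>!f. f \<in> Ar C X Z) \<and> (\<exists>!f. f \<in> Ar C Z X))"

definition biproduct :: "'o \<Rightarrow> 'o \<Rightarrow> 'o \<Rightarrow> 'm \<Rightarrow> 'm \<Rightarrow> 'm \<Rightarrow> 'm \<Rightarrow> bool" where
  "biproduct X Y P i j p q \<longleftrightarrow> P \<in> Obj C \<and>
     i \<in> Ar C X P \<and> j \<in> Ar C Y P \<and> p \<in> Ar C P X \<and> q \<in> Ar C P Y \<and>
     p \<cdot> i = Idm C X \<and> q \<cdot> j = Idm C Y \<and>
     p \<cdot> j = \<zero>\<^bsub>Hom C Y X\<^esub> \<and> q \<cdot> i = \<zero>\<^bsub>Hom C X Y\<^esub> \<and>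
     (i \<cdot> p) \<oplus>\<^bsub>Hom C P P\<^esub> (j \<cdot> q) = Idm C P"

definition kernel_of :: "'o \<Rightarrow> 'o \<Rightarrow> 'm \<Rightarrow> 'o \<Rightarrow> 'm \<Rightarrow> bool" where
  "kernel_of X Y f K i \<longleftrightarrow> K \<in> Obj C \<and> i \<in> Ar C K X \<and> f \<cdot> i = \<zero>\<^bsub>Hom C K Y\<^esub> \<and>
     (\<forall>W \<in> Obj C. \<forall>g \<in> Ar C W X. f \<cdot> g = \<zero>\<^bsub>Hom C W Y\<^esub> \<longrightarrow>
        (\<exists>!h. h \<in> Ar C W K \<and> i \<cdot> h = g))"

definition cokernel_of :: "'o \<Rightarrow> 'o \<Rightarrow> 'm \<Rightarrow> 'o \<Rightarrow> 'm \<Rightarrow> bool" where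
  "cokernel_of X Y f Q p \<longleftrightarrow> Q \<in> Obj C \<and> p \<in> Ar C Y Q \<and> p \<cdot> f = \<zero>\<^bsub>Hom C X Q\<^esub> \<and>
     (\<forall>W \<in> Obj C. \<forall>g \<in> Ar C Y W. g \<cdot> f = \<zero>\<^bsub>Hom C X W\<^esub> \<longrightarrow>
        (\<exists>!h. h \<in> Ar C Q W \<and> h \<cdot> p = g))"

definition simple_object :: "'o \<Rightarrow> bool" where
  "simple_object X \<longleftrightarrow> X \<in> Obj C \<and> \<not> zero_object X \<and>
     (\<forall>Y \<in> Obj C. \<forall>i. monic Y X i \<longrightarrow> zero_object Y \<or> iso_arrow Y X i)"

definition projective_object :: "'o \<Rightarrow> bool" where
  "projective_object P \<longleftrightarrow> P \<in> Obj C \<and>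
     (\<forall>X \<in> Obj C. \<forall>Y \<in> Obj C. \<forall>e. epic X Y e \<longrightarrow>
        (\<forall>f \<in> Ar C P Y. \<exists>g \<in> Ar C P X. e \<cdot> g = f))"

text \<open>Existence of a composition series, built up from the bottom one simple factor at a time.\<close>

inductive finite_length :: "'o \<Rightarrow> bool" where
  zero: "zero_object X \<Longrightarrow> finite_length X"
| extension: "\<lbrakk>finite_length Y; X \<in> Obj C; simple_object T;
    kernel_of X T p Y i; cokernel_of Y X i T p\<rbrakk> \<Longrightarrow> finite_length X"

end

locale abelian_category = linear_category k C
  for k :: "'k ring" and C :: "('k, 'o, 'm, 'z) lincat_scheme" (structure) +
  assumes ex_zero_object: "\<exists>Z. zero_object C Z"
    and ex_biproduct: "\<lbrakk>X \<in> Obj C; Y \<in> Obj C\<rbrakk> \<Longrightarrow> \<exists>P i j p q. biproduct C X Y P i j p q"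
    and ex_kernel: "\<lbrakk>X \<in> Obj C; Y \<in> Obj C; f \<in> Ar C X Y\<rbrakk> \<Longrightarrow> \<exists>K i. kernel_of C X Y f K i"
    and ex_cokernel: "\<lbrakk>X \<in> Obj C; Y \<in> Obj C; f \<in> Ar C X Y\<rbrakk> \<Longrightarrow> \<exists>Q p. cokernel_of C X Y f Q p"
    and monic_is_kernel: "\<lbrakk>X \<in> Obj C; Y \<in> Obj C; monic C X Y f\<rbrakk>
      \<Longrightarrow> \<exists>Z \<in> Obj C. \<exists>g \<in> Ar C Y Z. kernel_of C Y Z g X f"
    and epic_is_cokernel: "\<lbrakk>X \<in> Obj C; Y \<in> Obj C; epic C X Y f\<rbrakk>
      \<Longrightarrow> \<exists>Z \<in> Obj C. \<exists>g \<in> Ar C Z X. cokernel_of C Z X g Y f"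

locale finite_abelian_category = abelian_category k C
  for k :: "'k ring" and C :: "('k, 'o, 'm, 'z) lincat_scheme" (structure) +
  assumes hom_finite_dim: "\<lbrakk>X \<in> Obj C; Y \<in> Obj C\<rbrakk> \<Longrightarrow>
      \<exists>B. finite B \<and> B \<subseteq> Ar C X Y \<and>
        (\<forall>f \<in> Ar C X Y. \<exists>c \<in> B \<rightarrow> carrier k.
           f = finsum (Hom C X Y) (\<lambda>b. c b \<odot>\<^bsub>Hom C X Y\<^esub> b) B)"
    and obj_finite_length: "X \<in> Obj C \<Longrightarrow> finite_length C X"
    and enough_projectives: "X \<in> Obj C \<Longrightarrow> \<exists>P e. projective_object C P \<and> epic C P X e"
    and finitely_many_simples:
      "\<exists>F. finite F \<and> F \<subseteq> Obj C \<and> (\<forall>T. simple_object C T \<longrightarrow> (\<exists>T' \<in> F. isomorphic C T T'))"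

section \<open>Tensor categories\<close>

text \<open>
  Associativity and unit constraints are kept explicit. The chosen duals are
  \<open>ldual X\<close> = \<open>X*\<close> with \<open>ev X : X* \<otimes> X \<rightarrow> 1\<close>, \<open>coev X : 1 \<rightarrow> X \<otimes> X*\<close>, and
  \<open>rdual X\<close> = \<open>*X\<close> with \<open>evr X : X \<otimes> *X \<rightarrow> 1\<close>, \<open>coevr X : 1 \<rightarrow> *X \<otimes> X\<close>.
\<close>

record ('k, 'o, 'm) tensor_cat = "('k, 'o, 'm) lincat" +
  TUnit :: "'o"
  TObj :: "'o \<Rightarrow> 'o \<Rightarrow> 'o"  (infixr \<open>\<Otimes>\<index>\<close> 70)
  TArr :: "'m \<Rightarrow> 'm \<Rightarrow> 'm"  (infixr \<open>\<star>\<index>\<close> 70)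
  Assoc :: "'o \<Rightarrow> 'o \<Rightarrow> 'o \<Rightarrow> 'm"
  LUnit :: "'o \<Rightarrow> 'm"
  RUnit :: "'o \<Rightarrow> 'm"
  ldual :: "'o \<Rightarrow> 'o"
  ev :: "'o \<Rightarrow> 'm"
  coev :: "'o \<Rightarrow> 'm"
  rdual :: "'o \<Rightarrow> 'o"
  evr :: "'o \<Rightarrow> 'm"
  coevr :: "'o \<Rightarrow> 'm"

context
  fixes C :: "('k, 'o, 'm, 'z) tensor_cat_scheme" (structure)
begin

definition Assoc_inv :: "'o \<Rightarrow> 'o \<Rightarrow> 'o \<Rightarrow> 'm" where
  "Assoc_inv X Y Z = Inv C ((X \<Otimes> Y) \<Otimes> Z) (X \<Otimes> (Y \<Otimes> Z)) (Assoc C X Y Z)"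

definition LUnit_inv :: "'o \<Rightarrow> 'm" where
  "LUnit_inv X = Inv C (TUnit C \<Otimes> X) X (LUnit C X)"

definition RUnit_inv :: "'o \<Rightarrow> 'm" where
  "RUnit_inv X = Inv C (X \<Otimes> TUnit C) X (RUnit C X)"

end

locale tensor_category = finite_abelian_category k C
  for k :: "'k ring" and C :: "('k, 'o, 'm, 'z) tensor_cat_scheme" (structure) +
  assumes unit_obj: "TUnit C \<in> Obj C"
    and tensor_obj: "\<lbrakk>X \<in> Obj C; Y \<in> Obj C\<rbrakk> \<Longrightarrow> X \<Otimes> Y \<in> Obj C"
    and tensor_arr:
      "\<lbrakk>X \<in> Obj C; X' \<in> Obj C; Y \<in> Obj C; Y' \<in> Obj C; f \<in> Ar C X X'; g \<in> Ar C Y Y'\<rbrakk>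
        \<Longrightarrow> f \<star> g \<in> Ar C (X \<Otimes> Y) (X' \<Otimes> Y')"
    and tensor_id: "\<lbrakk>X \<in> Obj C; Y \<in> Obj C\<rbrakk> \<Longrightarrow> Idm C X \<star> Idm C Y = Idm C (X \<Otimes> Y)"
    and tensor_comp:
      "\<lbrakk>X \<in> Obj C; X' \<in> Obj C; X'' \<in> Obj C; Y \<in> Obj C; Y' \<in> Obj C; Y'' \<in> Obj C;
        f \<in> Ar C X X'; f' \<in> Ar C X' X''; g \<in> Ar C Y Y'; g' \<in> Ar C Y' Y''\<rbrakk>
        \<Longrightarrow> (f' \<cdot> f) \<star> (g' \<cdot> g) = (f' \<star> g') \<cdot> (f \<star> g)"
    and tensor_add_left:
      "\<lbrakk>X \<in> Obj C; X' \<in> Obj C; Y \<in> Obj C; Y' \<in> Obj C; f \<in> Ar C X X'; f' \<in> Ar C X X'; g \<in> Ar C Y Y'\<rbrakk>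
        \<Longrightarrow> (f \<oplus>\<^bsub>Hom C X X'\<^esub> f') \<star> g = (f \<star> g) \<oplus>\<^bsub>Hom C (X \<Otimes> Y) (X' \<Otimes> Y')\<^esub> (f' \<star> g)"
    and tensor_add_right:
      "\<lbrakk>X \<in> Obj C; X' \<in> Obj C; Y \<in> Obj C; Y' \<in> Obj C; f \<in> Ar C X X'; g \<in> Ar C Y Y'; g' \<in> Ar C Y Y'\<rbrakk>
        \<Longrightarrow> f \<star> (g \<oplus>\<^bsub>Hom C Y Y'\<^esub> g') = (f \<star> g) \<oplus>\<^bsub>Hom C (X \<Otimes> Y) (X' \<Otimes> Y')\<^esub> (f \<star> g')"
    and tensor_smult_left:
      "\<lbrakk>X \<in> Obj C; X' \<in> Obj C; Y \<in> Obj C; Y' \<in> Obj C; a \<in> carrier k; f \<in> Ar C X X'; g \<in> Ar C Y Y'\<rbrakk>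
        \<Longrightarrow> (a \<odot>\<^bsub>Hom C X X'\<^esub> f) \<star> g = a \<odot>\<^bsub>Hom C (X \<Otimes> Y) (X' \<Otimes> Y')\<^esub> (f \<star> g)"
    and tensor_smult_right:
      "\<lbrakk>X \<in> Obj C; X' \<in> Obj C; Y \<in> Obj C; Y' \<in> Obj C; a \<in> carrier k; f \<in> Ar C X X'; g \<in> Ar C Y Y'\<rbrakk>
        \<Longrightarrow> f \<star> (a \<odot>\<^bsub>Hom C Y Y'\<^esub> g) = a \<odot>\<^bsub>Hom C (X \<Otimes> Y) (X' \<Otimes> Y')\<^esub> (f \<star> g)"
    and assoc_iso: "\<lbrakk>X \<in> Obj C; Y \<in> Obj C; Z \<in> Obj C\<rbrakk>
        \<Longrightarrow> iso_arrow C ((X \<Otimes> Y) \<Otimes> Z) (X \<Otimes> (Y \<Otimes> Z)) (Assoc C X Y Z)"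
    and assoc_natural:
      "\<lbrakk>X \<in> Obj C; X' \<in> Obj C; Y \<in> Obj C; Y' \<in> Obj C; Z \<in> Obj C; Z' \<in> Obj C;
        f \<in> Ar C X X'; g \<in> Ar C Y Y'; h \<in> Ar C Z Z'\<rbrakk>
        \<Longrightarrow> Assoc C X' Y' Z' \<cdot> ((f \<star> g) \<star> h) = (f \<star> (g \<star> h)) \<cdot> Assoc C X Y Z"
    and lunit_iso: "X \<in> Obj C \<Longrightarrow> iso_arrow C (TUnit C \<Otimes> X) X (LUnit C X)"
    and lunit_natural: "\<lbrakk>X \<in> Obj C; Y \<in> Obj C; f \<in> Ar C X Y\<rbrakk>
        \<Longrightarrow> LUnit C Y \<cdot> (Idm C (TUnit C) \<star> f) = f \<cdot> LUnit C X"
    and runit_iso: "X \<in> Obj C \<Longrightarrow> iso_arrow C (X \<Otimes> TUnit C) X (RUnit C X)"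
    and runit_natural: "\<lbrakk>X \<in> Obj C; Y \<in> Obj C; f \<in> Ar C X Y\<rbrakk>
        \<Longrightarrow> RUnit C Y \<cdot> (f \<star> Idm C (TUnit C)) = f \<cdot> RUnit C X"
    and pentagon: "\<lbrakk>W \<in> Obj C; X \<in> Obj C; Y \<in> Obj C; Z \<in> Obj C\<rbrakk>
        \<Longrightarrow> (Idm C W \<star> Assoc C X Y Z) \<cdot> Assoc C W (X \<Otimes> Y) Z \<cdot> (Assoc C W X Y \<star> Idm C Z)
          = Assoc C W X (Y \<Otimes> Z) \<cdot> Assoc C (W \<Otimes> X) Y Z"
    and triangle: "\<lbrakk>X \<in> Obj C; Y \<in> Obj C\<rbrakk>
        \<Longrightarrow> (Idm C X \<star> LUnit C Y) \<cdot> Assoc C X (TUnit C) Y = RUnit C X \<star> Idm C Y"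
    and ldual_obj: "X \<in> Obj C \<Longrightarrow> ldual C X \<in> Obj C"
    and ev_arr: "X \<in> Obj C \<Longrightarrow> ev C X \<in> Ar C (ldual C X \<Otimes> X) (TUnit C)"
    and coev_arr: "X \<in> Obj C \<Longrightarrow> coev C X \<in> Ar C (TUnit C) (X \<Otimes> ldual C X)"
    and ldual_zigzag: "X \<in> Obj C \<Longrightarrow>
        RUnit C X \<cdot> (Idm C X \<star> ev C X) \<cdot> Assoc C X (ldual C X) X \<cdot> (coev C X \<star> Idm C X)
          \<cdot> LUnit_inv C X = Idm C X"
    and ldual_zigzag': "X \<in> Obj C \<Longrightarrow>
        LUnit C (ldual C X) \<cdot> (ev C X \<star> Idm C (ldual C X)) \<cdot> Assoc_inv C (ldual C X) X (ldual C X)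
          \<cdot> (Idm C (ldual C X) \<star> coev C X) \<cdot> RUnit_inv C (ldual C X) = Idm C (ldual C X)"
    and rdual_obj: "X \<in> Obj C \<Longrightarrow> rdual C X \<in> Obj C"
    and evr_arr: "X \<in> Obj C \<Longrightarrow> evr C X \<in> Ar C (X \<Otimes> rdual C X) (TUnit C)"
    and coevr_arr: "X \<in> Obj C \<Longrightarrow> coevr C X \<in> Ar C (TUnit C) (rdual C X \<Otimes> X)"
    and rdual_zigzag: "X \<in> Obj C \<Longrightarrow>
        LUnit C X \<cdot> (evr C X \<star> Idm C X) \<cdot> Assoc_inv C X (rdual C X) X \<cdot> (Idm C X \<star> coevr C X)
          \<cdot> RUnit_inv C X = Idm C X"
    and rdual_zigzag': "X \<in> Obj C \<Longrightarrow>
        RUnit C (rdual C X) \<cdot> (Idm C (rdual C X) \<star> evr C X) \<cdot> Assoc C (rdual C X) X (rdual C X)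
          \<cdot> (coevr C X \<star> Idm C (rdual C X)) \<cdot> LUnit_inv C (rdual C X) = Idm C (rdual C X)"
    and unit_simple: "simple_object C (TUnit C)"

context
  fixes C :: "('k, 'o, 'm, 'z) tensor_cat_scheme" (structure)
begin

text \<open>
  For \<open>g : X \<otimes> W \<rightarrow> V\<close>, \<open>rtranspose X W g : W \<rightarrow> *X \<otimes> V\<close> is the composite
  \<open>(id \<otimes> g) (coev \<otimes> id)\<close>.
\<close>

definition rtranspose :: "'o \<Rightarrow> 'o \<Rightarrow> 'm \<Rightarrow> 'm" where
  "rtranspose X W g =
     (Idm C (rdual C X) \<star> g) \<cdot> Assoc C (rdual C X) X W \<cdot> (coevr C X \<star> Idm C W) \<cdot> LUnit_inv C W"

text \<open>\<open>*f : *N \<rightarrow> *M\<close> for \<open>f : M \<rightarrow> N\<close>.\<close>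

definition rdual_arr :: "'o \<Rightarrow> 'o \<Rightarrow> 'm \<Rightarrow> 'm" where
  "rdual_arr M N f =
     RUnit C (rdual C M) \<cdot> rtranspose M (rdual C N) (evr C N \<cdot> (f \<star> Idm C (rdual C N)))"

text \<open>The canonical isomorphism \<open>X \<rightarrow> *(X*)\<close> underlying the identification of the two objects.\<close>

definition rdual_ldual :: "'o \<Rightarrow> 'm" where
  "rdual_ldual X = RUnit C (rdual C (ldual C X)) \<cdot> rtranspose (ldual C X) X (ev C X)"

text \<open>
  \<open>\<phi>\<^sup>l : *(X \<otimes> Y) \<rightarrow> *Y \<otimes> *X\<close>; the argument of the outer transpose is
  \<open>Y \<otimes> *(X \<otimes> Y) \<rightarrow> *X\<close>, obtained from the evaluation of \<open>X \<otimes> Y\<close>.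
\<close>

definition phi_l :: "'o \<Rightarrow> 'o \<Rightarrow> 'm" where
  "phi_l X Y =
     (let D = rdual C (X \<Otimes> Y)
      in rtranspose Y D
           (RUnit C (rdual C X) \<cdot> rtranspose X (Y \<Otimes> D) (evr C (X \<Otimes> Y) \<cdot> Assoc_inv C X Y D)))"

definition phi_l_inv :: "'o \<Rightarrow> 'o \<Rightarrow> 'm" where
  "phi_l_inv X Y = Inv C (rdual C (X \<Otimes> Y)) (rdual C Y \<Otimes> rdual C X) (phi_l X Y)"

end

section \<open>Algebras, modules and bimodules\<close>

record ('o, 'm) alg =
  AObj :: "'o"
  AMult :: "'m"
  AUnit :: "'m"

context
  fixes C :: "('k, 'o, 'm, 'z) tensor_cat_scheme" (structure) and A :: "('o, 'm) alg"
begin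

definition algebra_in :: bool where
  "algebra_in \<longleftrightarrow>
     AObj A \<in> Obj C \<and>
     AMult A \<in> Ar C (AObj A \<Otimes> AObj A) (AObj A) \<and>
     AUnit A \<in> Ar C (TUnit C) (AObj A) \<and>
     AMult A \<cdot> (AMult A \<star> Idm C (AObj A))
       = AMult A \<cdot> (Idm C (AObj A) \<star> AMult A) \<cdot> Assoc C (AObj A) (AObj A) (AObj A) \<and>
     AMult A \<cdot> (AUnit A \<star> Idm C (AObj A)) = LUnit C (AObj A) \<and>
     AMult A \<cdot> (Idm C (AObj A) \<star> AUnit A) = RUnit C (AObj A)"

definition right_action :: "'o \<Rightarrow> 'm \<Rightarrow> bool" where
  "right_action M r \<longleftrightarrow>
     M \<in> Obj C \<and> r \<in> Ar C (M \<Otimes> AObj A) M \<and>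
     r \<cdot> (r \<star> Idm C (AObj A)) = r \<cdot> (Idm C M \<star> AMult A) \<cdot> Assoc C M (AObj A) (AObj A) \<and>
     r \<cdot> (Idm C M \<star> AUnit A) = RUnit C M"

definition left_action :: "'o \<Rightarrow> 'm \<Rightarrow> bool" where
  "left_action M l \<longleftrightarrow>
     M \<in> Obj C \<and> l \<in> Ar C (AObj A \<Otimes> M) M \<and>
     l \<cdot> (AMult A \<star> Idm C M) = l \<cdot> (Idm C (AObj A) \<star> l) \<cdot> Assoc C (AObj A) (AObj A) M \<and>
     l \<cdot> (AUnit A \<star> Idm C M) = LUnit C M"

text \<open>Objects of the category of bimodules are triples (object, left action, right action).\<close>

definition bimod_cat :: "('k, 'o \<times> 'm \<times> 'm, 'm) lincat" where
  "bimod_cat = \<lparr>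
     Obj = {(B, l, r). left_action B l \<and> right_action B r \<and>
       r \<cdot> (l \<star> Idm C (AObj A)) = l \<cdot> (Idm C (AObj A) \<star> r) \<cdot> Assoc C (AObj A) B (AObj A)},
     Hom = (\<lambda>(B, l, r) (B', l', r'). (Hom C B B')\<lparr>carrier :=
       {f \<in> Ar C B B'. f \<cdot> l = l' \<cdot> (Idm C (AObj A) \<star> f) \<and> f \<cdot> r = r' \<cdot> (f \<star> Idm C (AObj A))}\<rparr>),
     Idm = (\<lambda>(B, l, r). Idm C B),
     Comp = Comp C\<rparr>"

definition regular_bimod :: "'o \<times> 'm \<times> 'm" where
  "regular_bimod = (AObj A, AMult A, AMult A)"

end

section \<open>Module categories and module ends\<close>

text \<open>
  The data of a left module category over a tensor category: \<open>X \<rhd> M\<close> on objects and arrows,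
  \<open>m : (X \<otimes> Y) \<rhd> M \<rightarrow> X \<rhd> (Y \<rhd> M)\<close>, and \<open>1 \<rhd> M \<rightarrow> M\<close>.
\<close>

record ('k, 'n, 'f, 'o, 'm) module_cat = "('k, 'n, 'f) lincat" +
  ActObj :: "'o \<Rightarrow> 'n \<Rightarrow> 'n"
  ActArr :: "'m \<Rightarrow> 'f \<Rightarrow> 'f"
  MAssoc :: "'o \<Rightarrow> 'o \<Rightarrow> 'n \<Rightarrow> 'f"
  MUnit :: "'n \<Rightarrow> 'f"

definition exact_module_category ::
  "('k, 'o, 'm, 'z) tensor_cat_scheme \<Rightarrow> ('k, 'n, 'f, 'o, 'm) module_cat \<Rightarrow> bool" where
  "exact_module_category C \<M> \<longleftrightarrow>
     (\<forall>P M. projective_object C P \<longrightarrow> M \<in> Obj \<M> \<longrightarrow> projective_object \<M> (ActObj \<M> P M))"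

text \<open>
  A functor \<open>S\<close> on \<open>\<M>\<^sup>o\<^sup>p \<times> \<M>\<close>: for \<open>f : M' \<rightarrow> M\<close> and \<open>g : N \<rightarrow> N'\<close>,
  \<open>FArr S M' M N N' f g : S(M, N) \<rightarrow> S(M', N')\<close>. Arrows do not determine their endpoints, so these
  are passed explicitly.
\<close>

record ('n, 'f, 'p, 'q) bifun =
  FObj :: "'n \<Rightarrow> 'n \<Rightarrow> 'p"
  FArr :: "'n \<Rightarrow> 'n \<Rightarrow> 'n \<Rightarrow> 'n \<Rightarrow> 'f \<Rightarrow> 'f \<Rightarrow> 'q"

text \<open>
  In all definitions below \<open>\<gamma> X M N : S(M, X \<rhd> N) \<rightarrow> S(X* \<rhd> M, N)\<close> is the pre-balancing.
\<close>

context
  fixes C :: "('k, 'o, 'm, 'z) tensor_cat_scheme"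
    and \<M> :: "('k, 'n, 'f, 'o, 'm) module_cat"
    and D :: "('k, 'p, 'q, 'y) lincat_scheme"
    and S :: "('n, 'f, 'p, 'q) bifun"
    and \<gamma> :: "'o \<Rightarrow> 'n \<Rightarrow> 'n \<Rightarrow> 'q"
begin

definition dinatural :: "'p \<Rightarrow> ('n \<Rightarrow> 'q) \<Rightarrow> bool" where
  "dinatural E \<pi> \<longleftrightarrow>
     (\<forall>M \<in> Obj \<M>. \<pi> M \<in> Ar D E (FObj S M M)) \<and>
     (\<forall>M \<in> Obj \<M>. \<forall>N \<in> Obj \<M>. \<forall>f \<in> Ar \<M> M N.
        FArr S M M M N (Idm \<M> M) f \<cdot>\<^bsub>D\<^esub> \<pi> M = FArr S M N N N f (Idm \<M> N) \<cdot>\<^bsub>D\<^esub> \<pi> N)"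

definition balanced :: "('n \<Rightarrow> 'q) \<Rightarrow> bool" where
  "balanced \<pi> \<longleftrightarrow>
     (\<forall>X \<in> Obj C. \<forall>M \<in> Obj \<M>.
        let X' = ldual C X; XM = ActObj \<M> X M; XXM = ActObj \<M> (X' \<Otimes>\<^bsub>C\<^esub> X) M in
        FArr S XXM M M M (MUnit \<M> M \<cdot>\<^bsub>\<M>\<^esub> ActArr \<M> (ev C X) (Idm \<M> M)) (Idm \<M> M) \<cdot>\<^bsub>D\<^esub> \<pi> M
        = FArr S XXM (ActObj \<M> X' XM) M M (MAssoc \<M> X' X M) (Idm \<M> M)
            \<cdot>\<^bsub>D\<^esub> \<gamma> X XM M \<cdot>\<^bsub>D\<^esub> \<pi> XM)"

definition is_module_end :: "'p \<Rightarrow> ('n \<Rightarrow> 'q) \<Rightarrow> bool" where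
  "is_module_end E \<pi> \<longleftrightarrow>
     E \<in> Obj D \<and> dinatural E \<pi> \<and> balanced \<pi> \<and>
     (\<forall>E' \<in> Obj D. \<forall>\<xi>. dinatural E' \<xi> \<and> balanced \<xi> \<longrightarrow>
        (\<exists>!h. h \<in> Ar D E' E \<and> (\<forall>M \<in> Obj \<M>. \<xi> M = \<pi> M \<cdot>\<^bsub>D\<^esub> h)))"

end

section \<open>Right modules over an algebra, and the functor \<open>(M, N) \<mapsto> *M \<otimes> N\<close>\<close>

context
  fixes C :: "('k, 'o, 'm, 'z) tensor_cat_scheme" (structure) and A :: "('o, 'm) alg"
begin

definition rmod_cat :: "('k, 'o \<times> 'm, 'm, 'o, 'm) module_cat" where
  "rmod_cat = \<lparr>
     Obj = {(M, r). right_action C A M r},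
     Hom = (\<lambda>(M, r) (N, s). (Hom C M N)\<lparr>carrier :=
       {f \<in> Ar C M N. f \<cdot> r = s \<cdot> (f \<star> Idm C (AObj A))}\<rparr>),
     Idm = (\<lambda>(M, r). Idm C M),
     Comp = Comp C,
     ActObj = (\<lambda>X (M, r). (X \<Otimes> M, (Idm C X \<star> r) \<cdot> Assoc C X M (AObj A))),
     ActArr = TArr C,
     MAssoc = (\<lambda>X Y (M, r). Assoc C X Y M),
     MUnit = (\<lambda>(M, r). LUnit C M)\<rparr>"

text \<open>
  The left action \<open>A \<otimes> *M \<rightarrow> *M\<close>, i.e. \<open>(id \<otimes> ev) (id \<otimes> \<rho> \<otimes> id) (coev \<otimes> id)\<close>.
\<close>

definition rdual_action :: "'o \<Rightarrow> 'm \<Rightarrow> 'm" where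
  "rdual_action M r =
     RUnit C (rdual C M) \<cdot>
     rtranspose C M (AObj A \<Otimes> rdual C M)
       (evr C M \<cdot> (r \<star> Idm C (rdual C M)) \<cdot> Assoc_inv C M (AObj A) (rdual C M))"

definition hom_bimod :: "'o \<times> 'm \<Rightarrow> 'o \<times> 'm \<Rightarrow> 'o \<times> 'm \<times> 'm" where
  "hom_bimod = (\<lambda>(M, r) (N, s).
     (rdual C M \<Otimes> N,
      (rdual_action M r \<star> Idm C N) \<cdot> Assoc_inv C (AObj A) (rdual C M) N,
      (Idm C (rdual C M) \<star> s) \<cdot> Assoc C (rdual C M) N (AObj A)))"

definition hom_bifun :: "('o \<times> 'm, 'm, 'o \<times> 'm \<times> 'm, 'm) bifun" where
  "hom_bifun = \<lparr>FObj = hom_bimod, FArr = (\<lambda>M' M N N' f g. rdual_arr C (fst M') (fst M) f \<star> g)\<rparr>"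

text \<open>
  The pre-balancing \<open>*M \<otimes> (X \<otimes> N) \<rightarrow> *(X* \<otimes> M) \<otimes> N\<close>, with the identification of \<open>X\<close> and
  \<open>*(X*)\<close> spelled out.
\<close>

definition hom_balancing :: "'o \<Rightarrow> 'o \<times> 'm \<Rightarrow> 'o \<times> 'm \<Rightarrow> 'm" where
  "hom_balancing X = (\<lambda>(M, r) (N, s).
     (phi_l_inv C (ldual C X) M \<star> Idm C N) \<cdot>
     ((Idm C (rdual C M) \<star> rdual_ldual C X) \<star> Idm C N) \<cdot>
     Assoc_inv C (rdual C M) X N)"

end

end

theory Submission
  imports Defs
begin

text \<open>
  Since \<open>C\<close> is rigid, an arrow \<open>\<xi>\<^sub>M : E \<rightarrow> *M \<otimes> M\<close> is the same thing as an arrow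
  \<open>t\<^sub>M : M \<otimes> E \<rightarrow> M\<close>. Transposing in this way, every condition on a family \<open>\<xi>\<close> out of a bimodule \<open>E\<close>
  becomes a condition on \<open>t\<close>. The left action on \<open>*M\<close> is the transpose of the right action of \<open>M\<close>, so
  left linearity of \<open>\<xi>\<^sub>M\<close> says that \<open>t\<^sub>M\<close> equalises the two ways of letting \<open>A\<close> act in the middle of
  \<open>M \<otimes> A \<otimes> E\<close>; right linearity says that \<open>t\<^sub>M\<close> is a map of right modules; dinaturality says that \<open>t\<close> is
  natural in \<open>M\<close>; and the equation of the module end says that \<open>t\<^bsub>X \<otimes> M\<^esub> = X \<otimes> t\<^sub>M\<close>
  (\<open>balancing_iff\<close>; \<open>cone_iff\<close> collects all four). In other words, a cone with vertex \<open>E\<close> is a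
  transformation of module functors from \<open>- \<otimes>\<^sub>A E\<close> to the identity of \<open>C\<^sub>A\<close>.

  Such a transformation is determined by its value at \<open>A\<close>, as in the Eilenberg-Watts theorem. The action
  \<open>\<rho> : M \<otimes> A \<rightarrow> M\<close> is a map of right modules whose source is \<open>M \<rhd> A\<close>. Naturality along it and
  \<open>t\<^bsub>M \<otimes> A\<^esub> = M \<otimes> t\<^sub>A\<close> give \<open>\<rho> (M \<otimes> t\<^sub>A) = t\<^sub>M (\<rho> \<otimes> E)\<close>, and inserting the unit \<open>\<eta>\<close> of \<open>A\<close> yields
  \<open>t\<^sub>M = \<rho> (M \<otimes> h)\<close> with \<open>h = t\<^sub>A (\<eta> \<otimes> E) : E \<rightarrow> A\<close> (\<open>t_factor\<close>). The linearity properties of \<open>t\<^sub>A\<close>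
  make \<open>h\<close> a map of bimodules, and \<open>h\<close> is recovered from \<open>t\<^sub>A\<close>. Undoing the transposition, \<open>\<xi>\<^sub>M\<close> factors
  uniquely through the transpose \<open>A \<rightarrow> *M \<otimes> M\<close> of the action, so the regular bimodule with these transposes
  is a module end (\<open>regular_bimod_module_end\<close>). Any other module end is isomorphic to it by the usual
  comparison of universal objects (\<open>module_end_unique\<close>).

  The work lies in the coherence isomorphisms. One arrow can belong to several hom-sets, so
  composites are computed with arrows that carry their end points; then all typing conditions can be
  decided by rewriting.
\<close>

section \<open>Typed arrows and coherence\<close>

text \<open>
  An arrow with its source and its target. The operations on these triples are total, and they are
  meaningful on those that satisfy \<open>arrow\<close> below.
\<close>

datatype ('o, 'm) tarr = TA (src: 'o) (raw: 'm) (tgt: 'o)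

context tensor_category
begin

definition arrow where
  "arrow f \<longleftrightarrow> src f \<in> Obj C \<and> tgt f \<in> Obj C \<and> raw f \<in> Ar C (src f) (tgt f)"

definition cmp  (infixr \<open>\<bullet>\<close> 55) where
  "g \<bullet> f = TA (src f) (raw g \<cdot> raw f) (tgt g)"

definition tns  (infixr \<open>\<boxtimes>\<close> 70) where
  "f \<boxtimes> g = TA (src f \<Otimes> src g) (raw f \<star> raw g) (tgt f \<Otimes> tgt g)"

definition ident  (\<open>\<iota>\<close>) where
  "\<iota> X = TA X (Idm C X) X"

abbreviation unit_object  (\<open>\<I>\<close>) where "\<I> \<equiv> TUnit C"

definition "asc X Y Z = TA ((X \<Otimes> Y) \<Otimes> Z) (Assoc C X Y Z) (X \<Otimes> (Y \<Otimes> Z))"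
definition "asc' X Y Z = TA (X \<Otimes> (Y \<Otimes> Z)) (Assoc_inv C X Y Z) ((X \<Otimes> Y) \<Otimes> Z)"
definition "lun X = TA (\<I> \<Otimes> X) (LUnit C X) X"
definition "lun' X = TA X (LUnit_inv C X) (\<I> \<Otimes> X)"
definition "run X = TA (X \<Otimes> \<I>) (RUnit C X) X"
definition "run' X = TA X (RUnit_inv C X) (X \<Otimes> \<I>)"

lemma Inv_inverse:
  assumes "iso_arrow C X Y f" "X \<in> Obj C" "Y \<in> Obj C"
  shows "inverse_arrows C X Y f (Inv C X Y f)"
proof -
  obtain g where g: "inverse_arrows C X Y f g"
    using assms by (auto simp: iso_arrow_def)
  have "h = g" if "inverse_arrows C X Y f h" for h
  proof -
    have "h = h \<cdot> (f \<cdot> g)" "(h \<cdot> f) \<cdot> g = g"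
      using that g assms by (auto simp: inverse_arrows_def comp_id id_comp)
    then show ?thesis
      using comp_assoc[of Y X Y X g f h] that g assms by (auto simp: inverse_arrows_def)
  qed
  then show ?thesis
    unfolding Inv_def using g by (metis theI)
qed

lemma Assoc_inverse:
  "\<lbrakk>X \<in> Obj C; Y \<in> Obj C; Z \<in> Obj C\<rbrakk> \<Longrightarrow>
    inverse_arrows C ((X \<Otimes> Y) \<Otimes> Z) (X \<Otimes> (Y \<Otimes> Z)) (Assoc C X Y Z) (Assoc_inv C X Y Z)"
  unfolding Assoc_inv_def by (intro Inv_inverse assoc_iso tensor_obj)
lemma LUnit_inverse: "X \<in> Obj C \<Longrightarrow> inverse_arrows C (\<I> \<Otimes> X) X (LUnit C X) (LUnit_inv C X)"
  unfolding LUnit_inv_def by (intro Inv_inverse lunit_iso tensor_obj unit_obj)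
lemma RUnit_inverse: "X \<in> Obj C \<Longrightarrow> inverse_arrows C (X \<Otimes> \<I>) X (RUnit C X) (RUnit_inv C X)"
  unfolding RUnit_inv_def by (intro Inv_inverse runit_iso tensor_obj unit_obj)

lemma src_tgt [simp]:
  "src (g \<bullet> f) = src f" "tgt (g \<bullet> f) = tgt g"
  "src (f \<boxtimes> h) = src f \<Otimes> src h" "tgt (f \<boxtimes> h) = tgt f \<Otimes> tgt h"
  "src (\<iota> X) = X" "tgt (\<iota> X) = X"
  "src (asc X Y Z) = (X \<Otimes> Y) \<Otimes> Z" "tgt (asc X Y Z) = X \<Otimes> (Y \<Otimes> Z)"
  "src (asc' X Y Z) = X \<Otimes> (Y \<Otimes> Z)" "tgt (asc' X Y Z) = (X \<Otimes> Y) \<Otimes> Z"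
  "src (lun X) = \<I> \<Otimes> X" "tgt (lun X) = X" "src (lun' X) = X" "tgt (lun' X) = \<I> \<Otimes> X"
  "src (run X) = X \<Otimes> \<I>" "tgt (run X) = X" "src (run' X) = X" "tgt (run' X) = X \<Otimes> \<I>"
  by (simp_all add: cmp_def tns_def ident_def asc_def asc'_def lun_def lun'_def run_def run'_def)

lemma tensor_obj' [simp]: "X \<in> Obj C \<Longrightarrow> Y \<in> Obj C \<Longrightarrow> X \<Otimes> Y \<in> Obj C"
  by (rule tensor_obj)

text \<open>
  As rewrite rules, these loop together with \<open>arrow_def\<close>, so they are removed where that definition is used
  for rewriting.
\<close>

lemma arrow_obj [simp]: "arrow f \<Longrightarrow> src f \<in> Obj C" "arrow f \<Longrightarrow> tgt f \<in> Obj C"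
  by (simp_all add: arrow_def)

lemma arrow_cmp [simp]: "arrow f \<Longrightarrow> arrow g \<Longrightarrow> src g = tgt f \<Longrightarrow> arrow (g \<bullet> f)"
  unfolding arrow_def cmp_def by (simp add: comp_arr[of "src f" "tgt f"])

lemma arrow_tns [simp]: "arrow f \<Longrightarrow> arrow h \<Longrightarrow> arrow (f \<boxtimes> h)"
  by (simp add: arrow_def tns_def tensor_arr del: arrow_obj)

lemma arrow_structural [simp]:
  "\<I> \<in> Obj C"
  "X \<in> Obj C \<Longrightarrow> arrow (\<iota> X)"
  "X \<in> Obj C \<Longrightarrow> Y \<in> Obj C \<Longrightarrow> Z \<in> Obj C \<Longrightarrow> arrow (asc X Y Z)"
  "X \<in> Obj C \<Longrightarrow> Y \<in> Obj C \<Longrightarrow> Z \<in> Obj C \<Longrightarrow> arrow (asc' X Y Z)"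
  "X \<in> Obj C \<Longrightarrow> arrow (lun X)" "X \<in> Obj C \<Longrightarrow> arrow (lun' X)"
  "X \<in> Obj C \<Longrightarrow> arrow (run X)" "X \<in> Obj C \<Longrightarrow> arrow (run' X)"
  using Assoc_inverse LUnit_inverse RUnit_inverse
  by (simp_all add: arrow_def ident_def asc_def asc'_def lun_def lun'_def run_def run'_def
      unit_obj id_arr inverse_arrows_def del: arrow_obj)

lemma cmp_assoc [simp]:
  "\<lbrakk>arrow f; arrow g; arrow h; src g = tgt f; src h = tgt g\<rbrakk> \<Longrightarrow> (h \<bullet> g) \<bullet> f = h \<bullet> (g \<bullet> f)"
  unfolding arrow_def cmp_def by (simp add: comp_assoc[of "src f" "tgt f" "tgt g" "tgt h"] del: arrow_obj)

lemma ident_cmp [simp]: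
  assumes "arrow f" "tgt f = X" shows "\<iota> X \<bullet> f = f"
  using id_comp[of "src f" "tgt f" "raw f"] assms
  by (cases f) (auto simp: arrow_def cmp_def ident_def simp del: arrow_obj)

lemma cmp_ident [simp]:
  assumes "arrow f" "src f = X" shows "f \<bullet> \<iota> X = f"
  using comp_id[of "src f" "tgt f" "raw f"] assms
  by (cases f) (auto simp: arrow_def cmp_def ident_def simp del: arrow_obj)

text \<open>
  Naturality of the associator only applies to an identity of a tensor product when it is split into two
  identities; steps that rely on this remove the rule.
\<close>

lemma tns_ident [simp]: "X \<in> Obj C \<Longrightarrow> Y \<in> Obj C \<Longrightarrow> \<iota> X \<boxtimes> \<iota> Y = \<iota> (X \<Otimes> Y)"
  by (simp add: tns_def ident_def tensor_id)

lemma interchange: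
  "\<lbrakk>arrow f; arrow f'; arrow g; arrow g'; src f' = tgt f; src g' = tgt g\<rbrakk>
    \<Longrightarrow> (f' \<boxtimes> g') \<bullet> (f \<boxtimes> g) = (f' \<bullet> f) \<boxtimes> (g' \<bullet> g)"
  unfolding arrow_def cmp_def tns_def
  by (simp add: tensor_comp[of "src f" "tgt f" "tgt f'" "src g" "tgt g" "tgt g'"] del: arrow_obj)

text \<open>
  Composites are kept nested to the right. Applied to an equation \<open>a \<bullet> b = c\<close>, this rule gives the form
  that can be used for rewriting when further arrows follow \<open>b\<close>.
\<close>

lemma reassoc:
  "\<lbrakk>a \<bullet> b = c; arrow a; arrow b; arrow t; src a = tgt b; src b = tgt t\<rbrakk> \<Longrightarrow> a \<bullet> (b \<bullet> t) = c \<bullet> t"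
  by (metis cmp_assoc)

lemma cancel_inv [simp]:
  "X \<in> Obj C \<Longrightarrow> Y \<in> Obj C \<Longrightarrow> Z \<in> Obj C \<Longrightarrow> asc X Y Z \<bullet> asc' X Y Z = \<iota> (X \<Otimes> (Y \<Otimes> Z))"
  "X \<in> Obj C \<Longrightarrow> Y \<in> Obj C \<Longrightarrow> Z \<in> Obj C \<Longrightarrow> asc' X Y Z \<bullet> asc X Y Z = \<iota> ((X \<Otimes> Y) \<Otimes> Z)"
  "X \<in> Obj C \<Longrightarrow> lun X \<bullet> lun' X = \<iota> X" "X \<in> Obj C \<Longrightarrow> lun' X \<bullet> lun X = \<iota> (\<I> \<Otimes> X)"
  "X \<in> Obj C \<Longrightarrow> run X \<bullet> run' X = \<iota> X" "X \<in> Obj C \<Longrightarrow> run' X \<bullet> run X = \<iota> (X \<Otimes> \<I>)"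
  using Assoc_inverse LUnit_inverse RUnit_inverse
  by (simp_all add: cmp_def ident_def asc_def asc'_def lun_def lun'_def run_def run'_def
      inverse_arrows_def)

lemmas cancel_inv_reassoc [simp] = cancel_inv [THEN reassoc]

lemma cancel_right:
  assumes "a \<bullet> b = a' \<bullet> b" "b \<bullet> b' = \<iota> X" "arrow a" "arrow a'" "arrow b" "arrow b'"
    "src a = X" "src a' = X" "tgt b = X" "tgt b' = src b"
  shows "a = a'"
proof -
  have *: "(f \<bullet> b) \<bullet> b' = f" if "arrow f" "src f = X" for f
    using that assms cmp_assoc[of b' b f] by (simp del: cmp_assoc)
  show ?thesis using *[of a] *[of a'] assms by metis
qed

lemma cancel_left:
  assumes "b \<bullet> a = b \<bullet> a'" "b' \<bullet> b = \<iota> X" "arrow a" "arrow a'" "arrow b" "arrow b'"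
    "tgt a = X" "tgt a' = X" "src b = X" "src b' = tgt b"
  shows "a = a'"
proof -
  have *: "b' \<bullet> (b \<bullet> f) = f" if "arrow f" "tgt f = X" for f
    using that assms cmp_assoc[of f b b', symmetric] by (simp del: cmp_assoc)
  show ?thesis using *[of a] *[of a'] assms by metis
qed

lemma asc_nat:
  "\<lbrakk>arrow f; arrow g; arrow h; src f = X; src g = Y; src h = Z; tgt f = X'; tgt g = Y'; tgt h = Z'\<rbrakk>
    \<Longrightarrow> asc X' Y' Z' \<bullet> ((f \<boxtimes> g) \<boxtimes> h) = (f \<boxtimes> (g \<boxtimes> h)) \<bullet> asc X Y Z"
  using assoc_natural[of "src f" "tgt f" "src g" "tgt g" "src h" "tgt h" "raw f" "raw g" "raw h"]
  by (auto simp: arrow_def cmp_def tns_def asc_def simp del: arrow_obj)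

lemma asc'_nat:
  assumes "arrow f" "arrow g" "arrow h" "src f = X" "src g = Y" "src h = Z"
    "tgt f = X'" "tgt g = Y'" "tgt h = Z'"
  shows "asc' X' Y' Z' \<bullet> (f \<boxtimes> (g \<boxtimes> h)) = ((f \<boxtimes> g) \<boxtimes> h) \<bullet> asc' X Y Z"
proof (rule cancel_left[where b = "asc X' Y' Z'" and b' = "asc' X' Y' Z'"])
  show "asc X' Y' Z' \<bullet> asc' X' Y' Z' \<bullet> (f \<boxtimes> g \<boxtimes> h) =
    asc X' Y' Z' \<bullet> ((f \<boxtimes> g) \<boxtimes> h) \<bullet> asc' X Y Z"
    using assms(1-3) unfolding assms(4-9)[symmetric]
    by (simp add: asc_nat[THEN reassoc])
qed (use assms in auto)

lemma lun_nat: "\<lbrakk>arrow f; src f = X; tgt f = Y\<rbrakk> \<Longrightarrow> lun Y \<bullet> (\<iota> \<I> \<boxtimes> f) = f \<bullet> lun X"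
  using lunit_natural[of "src f" "tgt f" "raw f"]
  by (auto simp: arrow_def cmp_def tns_def lun_def ident_def simp del: arrow_obj)

lemma run_nat: "\<lbrakk>arrow f; src f = X; tgt f = Y\<rbrakk> \<Longrightarrow> run Y \<bullet> (f \<boxtimes> \<iota> \<I>) = f \<bullet> run X"
  using runit_natural[of "src f" "tgt f" "raw f"]
  by (auto simp: arrow_def cmp_def tns_def run_def ident_def simp del: arrow_obj)

lemma lun'_nat:
  assumes "arrow f" "src f = X" "tgt f = Y"
  shows "lun' Y \<bullet> f = (\<iota> \<I> \<boxtimes> f) \<bullet> lun' X"
proof (rule cancel_left[where b = "lun Y" and b' = "lun' Y"])
  show "lun Y \<bullet> lun' Y \<bullet> f = lun Y \<bullet> (\<iota> \<I> \<boxtimes> f) \<bullet> lun' X"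
    using assms by (auto simp add: lun_nat[THEN reassoc])
qed (use assms in auto)

lemma pentagon_arrows: "\<lbrakk>W \<in> Obj C; X \<in> Obj C; Y \<in> Obj C; Z \<in> Obj C\<rbrakk>
  \<Longrightarrow> (\<iota> W \<boxtimes> asc X Y Z) \<bullet> asc W (X \<Otimes> Y) Z \<bullet> (asc W X Y \<boxtimes> \<iota> Z)
     = asc W X (Y \<Otimes> Z) \<bullet> asc (W \<Otimes> X) Y Z"
  using pentagon by (simp add: cmp_def tns_def asc_def ident_def)

lemma triangle_arrows: "\<lbrakk>X \<in> Obj C; Y \<in> Obj C\<rbrakk>
  \<Longrightarrow> (\<iota> X \<boxtimes> lun Y) \<bullet> asc X \<I> Y = run X \<boxtimes> \<iota> Y"
  using triangle by (simp add: cmp_def tns_def asc_def ident_def lun_def run_def)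

text \<open>
  Tensoring with the unit object is isomorphic to the identity functor, hence faithful. Coherence
  identities may therefore be checked after tensoring with \<open>\<I>\<close>, where the pentagon applies.
\<close>

lemma unit_tensor_faithful:
  assumes "\<iota> \<I> \<boxtimes> f = \<iota> \<I> \<boxtimes> g" "arrow f" "arrow g" "src f = src g" "tgt f = tgt g"
  shows "f = g"
proof (rule cancel_right[where b = "lun (src f)" and b' = "lun' (src f)"])
  show "f \<bullet> lun (src f) = g \<bullet> lun (src f)"
    using assms lun_nat[of f "src f" "tgt f"] lun_nat[of g "src f" "tgt f"] by simp
qed (use assms in auto)

lemma tensor_unit_faithful:
  assumes "f \<boxtimes> \<iota> \<I> = g \<boxtimes> \<iota> \<I>" "arrow f" "arrow g" "src f = src g" "tgt f = tgt g"
  shows "f = g"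
proof (rule cancel_right[where b = "run (src f)" and b' = "run' (src f)"])
  show "f \<bullet> run (src f) = g \<bullet> run (src f)"
    using assms run_nat[of f "src f" "tgt f"] run_nat[of g "src f" "tgt f"] by simp
qed (use assms in auto)

text \<open>
  Kelly's redundancy of the unit axioms: the pentagon for \<open>\<I>, \<I>, X, Y\<close> and two triangles give the
  equation tensored with \<open>\<I>\<close> and composed with an isomorphism.
\<close>

lemma lun_tensor:
  assumes [simp]: "X \<in> Obj C" "Y \<in> Obj C"
  shows "lun (X \<Otimes> Y) \<bullet> asc \<I> X Y = lun X \<boxtimes> \<iota> Y"
proof (rule unit_tensor_faithful)
  let ?b = "asc \<I> (\<I> \<Otimes> X) Y \<bullet> (asc \<I> \<I> X \<boxtimes> \<iota> Y)"
  let ?b' = "(asc' \<I> \<I> X \<boxtimes> \<iota> Y) \<bullet> asc' \<I> (\<I> \<Otimes> X) Y"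
  show "\<iota> \<I> \<boxtimes> (lun (X \<Otimes> Y) \<bullet> asc \<I> X Y) = \<iota> \<I> \<boxtimes> (lun X \<boxtimes> \<iota> Y)"
  proof (rule cancel_right[where b = ?b and b' = ?b'])
    have "(\<iota> \<I> \<boxtimes> (lun (X \<Otimes> Y) \<bullet> asc \<I> X Y)) \<bullet> ?b
      = (\<iota> \<I> \<boxtimes> lun (X \<Otimes> Y)) \<bullet> (\<iota> \<I> \<boxtimes> asc \<I> X Y) \<bullet> ?b"
      by (simp add: interchange[THEN reassoc])
    also have "\<dots> = (\<iota> \<I> \<boxtimes> lun (X \<Otimes> Y)) \<bullet> asc \<I> \<I> (X \<Otimes> Y) \<bullet> asc (\<I> \<Otimes> \<I>) X Y"
      by (simp add: pentagon_arrows)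
    also have "\<dots> = (run \<I> \<boxtimes> (\<iota> X \<boxtimes> \<iota> Y)) \<bullet> asc (\<I> \<Otimes> \<I>) X Y"
      by (simp add: triangle_arrows[THEN reassoc])
    also have "\<dots> = asc \<I> X Y \<bullet> ((run \<I> \<boxtimes> \<iota> X) \<boxtimes> \<iota> Y)"
      by (rule asc_nat[symmetric]) simp_all
    also have "\<dots> = asc \<I> X Y \<bullet> (((\<iota> \<I> \<boxtimes> lun X) \<boxtimes> \<iota> Y) \<bullet> (asc \<I> \<I> X \<boxtimes> \<iota> Y))"
      by (simp add: interchange triangle_arrows)
    also have "\<dots> = (\<iota> \<I> \<boxtimes> (lun X \<boxtimes> \<iota> Y)) \<bullet> ?b"
      by (simp add: asc_nat[THEN reassoc])
    finally show "(\<iota> \<I> \<boxtimes> (lun (X \<Otimes> Y) \<bullet> asc \<I> X Y)) \<bullet> ?b = (\<iota> \<I> \<boxtimes> (lun X \<boxtimes> \<iota> Y)) \<bullet> ?b" .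
  qed (simp_all add: interchange interchange[THEN reassoc])
qed simp_all

text \<open>
  The mirror image of \<open>lun_tensor\<close>, from the pentagon for \<open>X, Y, \<I>, \<I>\<close>.
\<close>

lemma run_tensor:
  assumes [simp]: "X \<in> Obj C" "Y \<in> Obj C"
  shows "(\<iota> X \<boxtimes> run Y) \<bullet> asc X Y \<I> = run (X \<Otimes> Y)"
proof (rule tensor_unit_faithful)
  show "((\<iota> X \<boxtimes> run Y) \<bullet> asc X Y \<I>) \<boxtimes> \<iota> \<I> = run (X \<Otimes> Y) \<boxtimes> \<iota> \<I>"
  proof (rule cancel_left[where b = "asc X Y \<I>" and b' = "asc' X Y \<I>"])
    have "asc X Y \<I> \<bullet> (((\<iota> X \<boxtimes> run Y) \<bullet> asc X Y \<I>) \<boxtimes> \<iota> \<I>)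
      = asc X Y \<I> \<bullet> ((\<iota> X \<boxtimes> run Y) \<boxtimes> \<iota> \<I>) \<bullet> (asc X Y \<I> \<boxtimes> \<iota> \<I>)"
      by (simp add: interchange)
    also have "\<dots> = (\<iota> X \<boxtimes> (run Y \<boxtimes> \<iota> \<I>)) \<bullet> asc X (Y \<Otimes> \<I>) \<I> \<bullet> (asc X Y \<I> \<boxtimes> \<iota> \<I>)"
      by (simp add: asc_nat[THEN reassoc])
    also have "\<dots> = (\<iota> X \<boxtimes> (\<iota> Y \<boxtimes> lun \<I>)) \<bullet> (\<iota> X \<boxtimes> asc Y \<I> \<I>)
        \<bullet> asc X (Y \<Otimes> \<I>) \<I> \<bullet> (asc X Y \<I> \<boxtimes> \<iota> \<I>)"
      by (simp add: interchange[THEN reassoc] triangle_arrows)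
    also have "\<dots> = (\<iota> X \<boxtimes> (\<iota> Y \<boxtimes> lun \<I>)) \<bullet> asc X Y (\<I> \<Otimes> \<I>) \<bullet> asc (X \<Otimes> Y) \<I> \<I>"
      by (simp add: pentagon_arrows)
    also have "\<dots> = asc X Y \<I> \<bullet> ((\<iota> X \<boxtimes> \<iota> Y) \<boxtimes> lun \<I>) \<bullet> asc (X \<Otimes> Y) \<I> \<I>"
      by (simp add: asc_nat[THEN reassoc] del: tns_ident)
    also have "\<dots> = asc X Y \<I> \<bullet> (run (X \<Otimes> Y) \<boxtimes> \<iota> \<I>)"
      by (simp add: triangle_arrows)
    finally show "asc X Y \<I> \<bullet> (((\<iota> X \<boxtimes> run Y) \<bullet> asc X Y \<I>) \<boxtimes> \<iota> \<I>)
      = asc X Y \<I> \<bullet> (run (X \<Otimes> Y) \<boxtimes> \<iota> \<I>)" .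
  qed simp_all
qed simp_all

lemma lun_unit_eq_run_unit: "lun \<I> = run \<I>"
proof (rule tensor_unit_faithful)
  \<comment> \<open>Naturality of \<open>lun\<close> along \<open>lun \<I>\<close>, with the common factor \<open>lun \<I>\<close> cancelled.\<close>
  have *: "lun (\<I> \<Otimes> \<I>) = \<iota> \<I> \<boxtimes> lun \<I>"
    by (rule cancel_left[where b = "lun \<I>" and b' = "lun' \<I>"]) (simp_all add: lun_nat)
  show "lun \<I> \<boxtimes> \<iota> \<I> = run \<I> \<boxtimes> \<iota> \<I>"
    using lun_tensor[of \<I> \<I>] triangle_arrows[of \<I> \<I>] * by simp
qed simp_all

text \<open>
  Naturality read from right to left; the target objects are written with \<open>tgt\<close>, so that they are
  determined by the left-hand side.
\<close>

lemma asc_nat_rev: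
  "\<lbrakk>arrow f; arrow g; arrow h; src f = X; src g = Y; src h = Z\<rbrakk>
    \<Longrightarrow> (f \<boxtimes> (g \<boxtimes> h)) \<bullet> asc X Y Z = asc (tgt f) (tgt g) (tgt h) \<bullet> ((f \<boxtimes> g) \<boxtimes> h)"
  using asc_nat[of f g h X Y Z] by simp

lemmas asc_nat_rev_reassoc = asc_nat_rev[THEN reassoc]

lemmas asc_nat_reassoc = asc_nat[THEN reassoc] and asc'_nat_reassoc = asc'_nat[THEN reassoc]
  and lun_nat_reassoc = lun_nat[THEN reassoc] and interchange_reassoc = interchange[THEN reassoc]

text \<open>
  The pentagon with some of its sides inverted, in the forms that arise when a counit, which contains an
  inverse associator, is moved past other associators.
\<close>

lemma pentagon_mixed:
  assumes [simp]: "W \<in> Obj C" "X \<in> Obj C" "Y \<in> Obj C" "Z \<in> Obj C"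
  shows "asc' W X (Y \<Otimes> Z) \<bullet> (\<iota> W \<boxtimes> asc X Y Z)
    = asc (W \<Otimes> X) Y Z \<bullet> (asc' W X Y \<boxtimes> \<iota> Z) \<bullet> asc' W (X \<Otimes> Y) Z"
proof (rule cancel_left[where b = "asc W X (Y \<Otimes> Z)" and b' = "asc' W X (Y \<Otimes> Z)"])
  have "asc W X (Y \<Otimes> Z) \<bullet> asc' W X (Y \<Otimes> Z) \<bullet> (\<iota> W \<boxtimes> asc X Y Z)
    = ((\<iota> W \<boxtimes> asc X Y Z) \<bullet> asc W (X \<Otimes> Y) Z \<bullet> (asc W X Y \<boxtimes> \<iota> Z))
        \<bullet> (asc' W X Y \<boxtimes> \<iota> Z) \<bullet> asc' W (X \<Otimes> Y) Z"
    by (simp add: interchange_reassoc)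
  then show "asc W X (Y \<Otimes> Z) \<bullet> asc' W X (Y \<Otimes> Z) \<bullet> (\<iota> W \<boxtimes> asc X Y Z)
    = asc W X (Y \<Otimes> Z) \<bullet> asc (W \<Otimes> X) Y Z \<bullet> (asc' W X Y \<boxtimes> \<iota> Z) \<bullet> asc' W (X \<Otimes> Y) Z"
    by (simp only: pentagon_arrows assms) simp
qed simp_all

lemma pentagon_inv:
  assumes [simp]: "W \<in> Obj C" "X \<in> Obj C" "Y \<in> Obj C" "Z \<in> Obj C"
  shows "(asc' W X Y \<boxtimes> \<iota> Z) \<bullet> asc' W (X \<Otimes> Y) Z \<bullet> (\<iota> W \<boxtimes> asc' X Y Z)
    = asc' (W \<Otimes> X) Y Z \<bullet> asc' W X (Y \<Otimes> Z)"
proof (rule cancel_left[where b = "asc (W \<Otimes> X) Y Z" and b' = "asc' (W \<Otimes> X) Y Z"])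
  have "asc (W \<Otimes> X) Y Z \<bullet> (asc' W X Y \<boxtimes> \<iota> Z) \<bullet> asc' W (X \<Otimes> Y) Z \<bullet> (\<iota> W \<boxtimes> asc' X Y Z)
    = (asc (W \<Otimes> X) Y Z \<bullet> (asc' W X Y \<boxtimes> \<iota> Z) \<bullet> asc' W (X \<Otimes> Y) Z) \<bullet> (\<iota> W \<boxtimes> asc' X Y Z)"
    by simp
  also have "\<dots> = asc' W X (Y \<Otimes> Z)"
    by (simp only: pentagon_mixed[symmetric] assms) (simp add: interchange)
  finally show "asc (W \<Otimes> X) Y Z \<bullet> (asc' W X Y \<boxtimes> \<iota> Z) \<bullet> asc' W (X \<Otimes> Y) Z \<bullet> (\<iota> W \<boxtimes> asc' X Y Z)
    = asc (W \<Otimes> X) Y Z \<bullet> asc' (W \<Otimes> X) Y Z \<bullet> asc' W X (Y \<Otimes> Z)" by simp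
qed simp_all

lemma pentagon_mixed':
  assumes [simp]: "W \<in> Obj C" "X \<in> Obj C" "Y \<in> Obj C" "Z \<in> Obj C"
  shows "(asc W X Y \<boxtimes> \<iota> Z) \<bullet> asc' (W \<Otimes> X) Y Z
    = asc' W (X \<Otimes> Y) Z \<bullet> (\<iota> W \<boxtimes> asc' X Y Z) \<bullet> asc W X (Y \<Otimes> Z)"
proof (rule cancel_right[where b = "asc' W X (Y \<Otimes> Z)" and b' = "asc W X (Y \<Otimes> Z)"])
  have "((asc W X Y \<boxtimes> \<iota> Z) \<bullet> asc' (W \<Otimes> X) Y Z) \<bullet> asc' W X (Y \<Otimes> Z)
    = (asc W X Y \<boxtimes> \<iota> Z) \<bullet> (asc' W X Y \<boxtimes> \<iota> Z) \<bullet> asc' W (X \<Otimes> Y) Z \<bullet> (\<iota> W \<boxtimes> asc' X Y Z)"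
    by (simp add: pentagon_inv[symmetric])
  then show "((asc W X Y \<boxtimes> \<iota> Z) \<bullet> asc' (W \<Otimes> X) Y Z) \<bullet> asc' W X (Y \<Otimes> Z)
    = (asc' W (X \<Otimes> Y) Z \<bullet> (\<iota> W \<boxtimes> asc' X Y Z) \<bullet> asc W X (Y \<Otimes> Z)) \<bullet> asc' W X (Y \<Otimes> Z)"
    by (simp add: interchange_reassoc)
qed simp_all

lemma lun'_tensor:
  assumes [simp]: "V \<in> Obj C" "Z \<in> Obj C"
  shows "asc' \<I> V Z \<bullet> lun' (V \<Otimes> Z) = lun' V \<boxtimes> \<iota> Z"
proof (rule cancel_left[where b = "lun V \<boxtimes> \<iota> Z" and b' = "lun' V \<boxtimes> \<iota> Z"])
  have "(lun V \<boxtimes> \<iota> Z) \<bullet> asc' \<I> V Z \<bullet> lun' (V \<Otimes> Z) = \<iota> (V \<Otimes> Z)"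
    by (simp add: lun_tensor[symmetric])
  then show "(lun V \<boxtimes> \<iota> Z) \<bullet> asc' \<I> V Z \<bullet> lun' (V \<Otimes> Z) = (lun V \<boxtimes> \<iota> Z) \<bullet> (lun' V \<boxtimes> \<iota> Z)"
    by (simp add: interchange)
qed (simp_all add: interchange)

lemma triangle':
  assumes [simp]: "V \<in> Obj C" "Z \<in> Obj C"
  shows "asc' V \<I> Z \<bullet> (\<iota> V \<boxtimes> lun' Z) = run' V \<boxtimes> \<iota> Z"
proof (rule cancel_left[where b = "run V \<boxtimes> \<iota> Z" and b' = "run' V \<boxtimes> \<iota> Z"])
  show "(run V \<boxtimes> \<iota> Z) \<bullet> asc' V \<I> Z \<bullet> (\<iota> V \<boxtimes> lun' Z) = (run V \<boxtimes> \<iota> Z) \<bullet> (run' V \<boxtimes> \<iota> Z)"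
  proof -
    have "(run V \<boxtimes> \<iota> Z) \<bullet> asc' V \<I> Z \<bullet> (\<iota> V \<boxtimes> lun' Z) = (\<iota> V \<boxtimes> lun Z) \<bullet> (\<iota> V \<boxtimes> lun' Z)"
      by (simp add: triangle_arrows[symmetric])
    then show ?thesis by (simp add: interchange)
  qed
qed (simp_all add: interchange)

section \<open>Dual pairings and transposition\<close>

text \<open>
  For a pairing \<open>e : Y \<otimes> D \<rightarrow> 1\<close> and a copairing \<open>c : 1 \<rightarrow> D \<otimes> Y\<close>, the functor \<open>Y \<otimes> -\<close> is left adjoint
  to \<open>D \<otimes> -\<close>. The counit of this adjunction is \<open>Y \<otimes> (D \<otimes> V) \<rightarrow> V\<close>, and \<open>adjunct\<close> sends \<open>Y \<otimes> W \<rightarrow> V\<close> to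
  \<open>W \<rightarrow> D \<otimes> V\<close>. For \<open>V = 1\<close> this turns a pairing \<open>Y \<otimes> B \<rightarrow> 1\<close> into its \<open>mate\<close> \<open>B \<rightarrow> D\<close>.
\<close>

definition "counit Y D e V = lun V \<bullet> (e \<boxtimes> \<iota> V) \<bullet> asc' Y D V"

definition "adjunct Y D c W g = (\<iota> D \<boxtimes> g) \<bullet> asc D Y W \<bullet> (c \<boxtimes> \<iota> W) \<bullet> lun' W"

definition "mate Y D c B g = run D \<bullet> adjunct Y D c B g"

end

text \<open>
  Both kinds of duality are instances: \<open>(X, *X)\<close> and \<open>(X*, X)\<close>. In the second, \<open>X*\<close> plays the role of \<open>Y\<close>, so
  \<open>zigzag1\<close> is the zigzag identity on \<open>X*\<close> and \<open>zigzag2\<close> the one on \<open>X\<close>.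
\<close>

locale dual_pairing = tensor_category k C
  for k :: "'k ring" and C :: "('k, 'o, 'm, 'z) tensor_cat_scheme" (structure) +
  fixes Y D :: 'o and e c :: "('o, 'm) tarr"
  assumes pair_simps [simp]:
      "Y \<in> Obj C" "D \<in> Obj C" "arrow e" "src e = Y \<Otimes> D" "tgt e = \<I>" "arrow c" "src c = \<I>"
      "tgt c = D \<Otimes> Y"
    and zigzag1: "lun Y \<bullet> (e \<boxtimes> \<iota> Y) \<bullet> asc' Y D Y \<bullet> (\<iota> Y \<boxtimes> c) \<bullet> run' Y = \<iota> Y"
    and zigzag2: "run D \<bullet> (\<iota> D \<boxtimes> e) \<bullet> asc D Y D \<bullet> (c \<boxtimes> \<iota> D) \<bullet> lun' D = \<iota> D"
begin

lemma counit_type [simp]: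
  "V \<in> Obj C \<Longrightarrow> arrow (counit Y D e V)"
  "src (counit Y D e V) = Y \<Otimes> (D \<Otimes> V)" "tgt (counit Y D e V) = V"
  by (simp_all add: counit_def)

lemma adjunct_type [simp]:
  "\<lbrakk>W \<in> Obj C; arrow g; src g = Y \<Otimes> W\<rbrakk> \<Longrightarrow> arrow (adjunct Y D c W g)"
  "src (adjunct Y D c W g) = W" "tgt (adjunct Y D c W g) = D \<Otimes> tgt g"
  by (simp_all add: adjunct_def)

lemma counit_nat:
  assumes [simp]: "arrow v" and "src v = V" "tgt v = V'"
  shows "counit Y D e V' \<bullet> (\<iota> Y \<boxtimes> (\<iota> D \<boxtimes> v)) = v \<bullet> counit Y D e V"
proof -
  have [simp]: "V \<in> Obj C" "V' \<in> Obj C" and v[simp]: "src v = V" "tgt v = V'" using assms by auto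
  have "counit Y D e V' \<bullet> (\<iota> Y \<boxtimes> (\<iota> D \<boxtimes> v)) = lun V' \<bullet> (e \<boxtimes> v) \<bullet> asc' Y D V"
    by (simp add: counit_def asc'_nat interchange_reassoc)
  also have "\<dots> = lun V' \<bullet> (\<iota> \<I> \<boxtimes> v) \<bullet> (e \<boxtimes> \<iota> V) \<bullet> asc' Y D V"
    by (simp add: interchange_reassoc)
  also have "\<dots> = v \<bullet> counit Y D e V"
    by (simp add: counit_def lun_nat_reassoc)
  finally show ?thesis .
qed

text \<open>
  The counit at \<open>V \<otimes> Z\<close> is, up to associativity, the counit at \<open>V\<close> tensored with \<open>Z\<close>. This is what
  makes right actions on \<open>V\<close> compatible with transposition.
\<close>

lemma counit_tensor:
  assumes [simp]: "V \<in> Obj C" "Z \<in> Obj C"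
  shows "counit Y D e (V \<Otimes> Z) \<bullet> (\<iota> Y \<boxtimes> asc D V Z) = (counit Y D e V \<boxtimes> \<iota> Z) \<bullet> asc' Y (D \<Otimes> V) Z"
proof -
  have "counit Y D e (V \<Otimes> Z) \<bullet> (\<iota> Y \<boxtimes> asc D V Z)
    = lun (V \<Otimes> Z) \<bullet> (e \<boxtimes> (\<iota> V \<boxtimes> \<iota> Z)) \<bullet> asc (Y \<Otimes> D) V Z \<bullet> (asc' Y D V \<boxtimes> \<iota> Z) \<bullet> asc' Y (D \<Otimes> V) Z"
    by (simp add: counit_def pentagon_mixed)
  also have "\<dots> = lun (V \<Otimes> Z) \<bullet> asc \<I> V Z \<bullet> ((e \<boxtimes> \<iota> V) \<boxtimes> \<iota> Z) \<bullet> (asc' Y D V \<boxtimes> \<iota> Z) \<bullet> asc' Y (D \<Otimes> V) Z"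
    by (simp add: asc_nat_reassoc del: tns_ident)
  also have "\<dots> = (counit Y D e V \<boxtimes> \<iota> Z) \<bullet> asc' Y (D \<Otimes> V) Z"
    by (simp add: counit_def lun_tensor[THEN reassoc] interchange_reassoc)
  finally show ?thesis .
qed

text \<open>
  One half of the adjunction; it reduces to the first zigzag tensored with \<open>W\<close>.
\<close>

lemma counit_adjunct:
  assumes [simp]: "W \<in> Obj C" "arrow g" "src g = Y \<Otimes> W" and "tgt g = V"
  shows "counit Y D e V \<bullet> (\<iota> Y \<boxtimes> adjunct Y D c W g) = g"
proof -
  have [simp]: "V \<in> Obj C" "tgt g = V" using assms by auto
  have "counit Y D e V \<bullet> (\<iota> Y \<boxtimes> adjunct Y D c W g)
    = counit Y D e V \<bullet> (\<iota> Y \<boxtimes> (\<iota> D \<boxtimes> g)) \<bullet> (\<iota> Y \<boxtimes> asc D Y W) \<bullet> (\<iota> Y \<boxtimes> (c \<boxtimes> \<iota> W)) \<bullet> (\<iota> Y \<boxtimes> lun' W)"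
    by (simp add: adjunct_def interchange)
  also have "\<dots> = g \<bullet> (counit Y D e Y \<boxtimes> \<iota> W) \<bullet> asc' Y (D \<Otimes> Y) W \<bullet> (\<iota> Y \<boxtimes> (c \<boxtimes> \<iota> W)) \<bullet> (\<iota> Y \<boxtimes> lun' W)"
    by (simp add: counit_nat[THEN reassoc] counit_tensor[THEN reassoc])
  also have "\<dots> = g \<bullet> (counit Y D e Y \<boxtimes> \<iota> W) \<bullet> ((\<iota> Y \<boxtimes> c) \<boxtimes> \<iota> W) \<bullet> (run' Y \<boxtimes> \<iota> W)"
    by (simp add: asc'_nat_reassoc triangle')
  also have "\<dots> = g \<bullet> ((lun Y \<bullet> (e \<boxtimes> \<iota> Y) \<bullet> asc' Y D Y \<bullet> (\<iota> Y \<boxtimes> c) \<bullet> run' Y) \<boxtimes> \<iota> W)"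
    by (simp add: interchange counit_def)
  also have "\<dots> = g" by (simp add: zigzag1)
  finally show ?thesis .
qed

text \<open>
  The other half; naturality moves \<open>t\<close> to the right, and what remains is the second zigzag tensored with
  \<open>V\<close>.
\<close>

lemma adjunct_counit:
  assumes [simp]: "arrow t" "V \<in> Obj C" "tgt t = D \<Otimes> V" and "src t = W"
  shows "adjunct Y D c W (counit Y D e V \<bullet> (\<iota> Y \<boxtimes> t)) = t"
proof -
  have [simp]: "W \<in> Obj C" "src t = W" using assms by auto
  have "adjunct Y D c W (counit Y D e V \<bullet> (\<iota> Y \<boxtimes> t))
    = (\<iota> D \<boxtimes> counit Y D e V) \<bullet> (\<iota> D \<boxtimes> (\<iota> Y \<boxtimes> t)) \<bullet> asc D Y W \<bullet> (c \<boxtimes> \<iota> W) \<bullet> lun' W"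
    by (simp add: adjunct_def interchange_reassoc)
  also have "\<dots> = (\<iota> D \<boxtimes> counit Y D e V) \<bullet> asc D Y (D \<Otimes> V) \<bullet> ((\<iota> D \<boxtimes> \<iota> Y) \<boxtimes> t) \<bullet> (c \<boxtimes> \<iota> W) \<bullet> lun' W"
    by (simp add: asc_nat_rev_reassoc del: tns_ident)
  also have "\<dots> = (\<iota> D \<boxtimes> counit Y D e V) \<bullet> asc D Y (D \<Otimes> V) \<bullet> (c \<boxtimes> t) \<bullet> lun' W"
    by (simp add: interchange_reassoc)
  also have "\<dots> = (\<iota> D \<boxtimes> counit Y D e V) \<bullet> asc D Y (D \<Otimes> V) \<bullet> (c \<boxtimes> \<iota> (D \<Otimes> V)) \<bullet> (\<iota> \<I> \<boxtimes> t) \<bullet> lun' W"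
    by (simp add: interchange_reassoc)
  also have "\<dots> = (\<iota> D \<boxtimes> counit Y D e V) \<bullet> asc D Y (D \<Otimes> V) \<bullet> (c \<boxtimes> \<iota> (D \<Otimes> V)) \<bullet> lun' (D \<Otimes> V) \<bullet> t"
    by (simp add: lun'_nat)
  also have "\<dots> = (\<iota> D \<boxtimes> (lun V \<bullet> (e \<boxtimes> \<iota> V))) \<bullet> asc D (Y \<Otimes> D) V
      \<bullet> (asc D Y D \<boxtimes> \<iota> V) \<bullet> asc' (D \<Otimes> Y) D V \<bullet> (c \<boxtimes> (\<iota> D \<boxtimes> \<iota> V)) \<bullet> lun' (D \<Otimes> V) \<bullet> t"
  proof -
    have "(\<iota> D \<boxtimes> asc' Y D V) \<bullet> asc D Y (D \<Otimes> V) = asc D (Y \<Otimes> D) V \<bullet> (asc D Y D \<boxtimes> \<iota> V) \<bullet> asc' (D \<Otimes> Y) D V"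
    proof (rule cancel_left[where b = "\<iota> D \<boxtimes> asc Y D V" and b' = "\<iota> D \<boxtimes> asc' Y D V"])
      have "(\<iota> D \<boxtimes> asc Y D V) \<bullet> asc D (Y \<Otimes> D) V \<bullet> (asc D Y D \<boxtimes> \<iota> V) \<bullet> asc' (D \<Otimes> Y) D V
        = ((\<iota> D \<boxtimes> asc Y D V) \<bullet> asc D (Y \<Otimes> D) V \<bullet> (asc D Y D \<boxtimes> \<iota> V)) \<bullet> asc' (D \<Otimes> Y) D V"
        by simp
      also have "\<dots> = asc D Y (D \<Otimes> V)" by (simp only: pentagon_arrows pair_simps assms) simp
      finally show "(\<iota> D \<boxtimes> asc Y D V) \<bullet> (\<iota> D \<boxtimes> asc' Y D V) \<bullet> asc D Y (D \<Otimes> V)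
        = (\<iota> D \<boxtimes> asc Y D V) \<bullet> asc D (Y \<Otimes> D) V \<bullet> (asc D Y D \<boxtimes> \<iota> V) \<bullet> asc' (D \<Otimes> Y) D V"
        by (simp add: interchange_reassoc)
    qed (simp_all add: interchange)
    note * = this[THEN reassoc]
    have "\<iota> D \<boxtimes> counit Y D e V = (\<iota> D \<boxtimes> (lun V \<bullet> (e \<boxtimes> \<iota> V))) \<bullet> (\<iota> D \<boxtimes> asc' Y D V)"
      by (simp add: counit_def interchange)
    then show ?thesis by (simp add: *)
  qed
  also have "\<dots> = (\<iota> D \<boxtimes> lun V) \<bullet> (\<iota> D \<boxtimes> (e \<boxtimes> \<iota> V)) \<bullet> asc D (Y \<Otimes> D) V
      \<bullet> (asc D Y D \<boxtimes> \<iota> V) \<bullet> ((c \<boxtimes> \<iota> D) \<boxtimes> \<iota> V) \<bullet> (lun' D \<boxtimes> \<iota> V) \<bullet> t"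
    by (simp add: interchange_reassoc asc'_nat_reassoc lun'_tensor[THEN reassoc] del: tns_ident)
  also have "\<dots> = (run D \<boxtimes> \<iota> V) \<bullet> ((\<iota> D \<boxtimes> e) \<boxtimes> \<iota> V) 
      \<bullet> (asc D Y D \<boxtimes> \<iota> V) \<bullet> ((c \<boxtimes> \<iota> D) \<boxtimes> \<iota> V) \<bullet> (lun' D \<boxtimes> \<iota> V) \<bullet> t"
    by (simp add: asc_nat_rev_reassoc triangle_arrows[THEN reassoc])
  also have "\<dots> = ((run D \<bullet> (\<iota> D \<boxtimes> e) \<bullet> asc D Y D \<bullet> (c \<boxtimes> \<iota> D) \<bullet> lun' D) \<boxtimes> \<iota> V) \<bullet> t"
    by (simp add: interchange_reassoc interchange)
  also have "\<dots> = t" by (simp add: zigzag2)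
  finally show ?thesis .
qed

lemma counit_inject:
  assumes "counit Y D e V \<bullet> (\<iota> Y \<boxtimes> t) = counit Y D e V \<bullet> (\<iota> Y \<boxtimes> t')"
    "arrow t" "arrow t'" "V \<in> Obj C" "tgt t = D \<Otimes> V" "tgt t' = D \<Otimes> V" "src t = src t'"
  shows "t = t'"
  using assms adjunct_counit[of t V "src t"] adjunct_counit[of t' V "src t"] by metis

text \<open>
  An arrow into \<open>D\<close> enters the counit only through its pairing with \<open>Y\<close>. All arrows between duals used
  below (duals of arrows, the actions on duals, \<open>\<phi>\<^sup>l\<close>) are characterised by such pairings.
\<close>

lemma counit_slide:
  assumes [simp]: "arrow d" "tgt d = D" "V \<in> Obj C" and "src d = B"
  shows "counit Y D e V \<bullet> (\<iota> Y \<boxtimes> (d \<boxtimes> \<iota> V)) = lun V \<bullet> ((e \<bullet> (\<iota> Y \<boxtimes> d)) \<boxtimes> \<iota> V) \<bullet> asc' Y B V"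
proof -
  have [simp]: "B \<in> Obj C" "src d = B" using assms by auto
  show ?thesis by (simp add: counit_def asc'_nat interchange_reassoc)
qed

text \<open>
  At \<open>V = \<I>\<close> the counit is the pairing itself; here the two unit constraints of \<open>\<I>\<close> must agree.
\<close>

lemma counit_unit: "e \<bullet> (\<iota> Y \<boxtimes> run D) = counit Y D e \<I>"
proof -
  have "e \<bullet> (\<iota> Y \<boxtimes> run D) = e \<bullet> run (Y \<Otimes> D) \<bullet> asc' Y D \<I>"
    by (simp add: run_tensor[symmetric])
  also have "\<dots> = counit Y D e \<I>"
    by (simp add: counit_def lun_unit_eq_run_unit run_nat[THEN reassoc])
  finally show ?thesis .
qed

lemma mate_type [simp]:
  "\<lbrakk>B \<in> Obj C; arrow g; src g = Y \<Otimes> B; tgt g = \<I>\<rbrakk> \<Longrightarrow> arrow (mate Y D c B g)"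
  "src (mate Y D c B g) = B" "tgt (mate Y D c B g) = D"
  by (simp_all add: mate_def)

lemma pairing_mate:
  assumes [simp]: "B \<in> Obj C" "arrow g" "src g = Y \<Otimes> B" "tgt g = \<I>"
  shows "e \<bullet> (\<iota> Y \<boxtimes> mate Y D c B g) = g"
proof -
  have "e \<bullet> (\<iota> Y \<boxtimes> mate Y D c B g) = e \<bullet> (\<iota> Y \<boxtimes> run D) \<bullet> (\<iota> Y \<boxtimes> adjunct Y D c B g)"
    by (simp add: mate_def interchange)
  also have "\<dots> = g" by (simp add: counit_unit[THEN reassoc] counit_adjunct)
  finally show ?thesis .
qed

lemma pairing_inject:
  assumes "e \<bullet> (\<iota> Y \<boxtimes> d) = e \<bullet> (\<iota> Y \<boxtimes> d')" "arrow d" "arrow d'" "tgt d = D" "tgt d' = D" "src d = src d'"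
  shows "d = d'"
proof -
  have *: "counit Y D e \<I> \<bullet> (\<iota> Y \<boxtimes> (run' D \<bullet> f)) = e \<bullet> (\<iota> Y \<boxtimes> f)" if "arrow f" "tgt f = D" for f
    using that by (simp add: counit_unit[symmetric] interchange)
  have "run' D \<bullet> d = run' D \<bullet> d'"
  proof (rule counit_inject)
    show "counit Y D e \<I> \<bullet> (\<iota> Y \<boxtimes> (run' D \<bullet> d)) = counit Y D e \<I> \<bullet> (\<iota> Y \<boxtimes> (run' D \<bullet> d'))"
      using *[of d] *[of d'] assms by metis
  qed (simp_all add: assms(2-))
  then show ?thesis
    by (rule cancel_left[where b' = "run D" and X = D]) (simp_all add: assms(2-))
qed

end

context tensor_category
begin

section \<open>Duals and their canonical isomorphisms\<close>

definition "evR X = TA (X \<Otimes> rdual C X) (evr C X) \<I>"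
definition "coevR X = TA \<I> (coevr C X) (rdual C X \<Otimes> X)"
definition "evL X = TA (ldual C X \<Otimes> X) (ev C X) \<I>"
definition "coevL X = TA \<I> (coev C X) (X \<Otimes> ldual C X)"

lemma dual_obj [simp]: "X \<in> Obj C \<Longrightarrow> rdual C X \<in> Obj C" "X \<in> Obj C \<Longrightarrow> ldual C X \<in> Obj C"
  by (fact rdual_obj ldual_obj)+

lemma ev_type [simp]:
  "src (evR X) = X \<Otimes> rdual C X" "tgt (evR X) = \<I>" "src (coevR X) = \<I>" "tgt (coevR X) = rdual C X \<Otimes> X"
  "src (evL X) = ldual C X \<Otimes> X" "tgt (evL X) = \<I>" "src (coevL X) = \<I>" "tgt (coevL X) = X \<Otimes> ldual C X"
  "X \<in> Obj C \<Longrightarrow> arrow (evR X)" "X \<in> Obj C \<Longrightarrow> arrow (coevR X)"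
  "X \<in> Obj C \<Longrightarrow> arrow (evL X)" "X \<in> Obj C \<Longrightarrow> arrow (coevL X)"
  by (simp_all add: evR_def coevR_def evL_def coevL_def arrow_def evr_arr coevr_arr ev_arr coev_arr
      del: arrow_obj)

lemma dual_pairing_rdual: "X \<in> Obj C \<Longrightarrow> dual_pairing k C X (rdual C X) (evR X) (coevR X)"
  by unfold_locales
    (simp_all, simp_all add: cmp_def tns_def ident_def asc_def asc'_def lun_def lun'_def run_def run'_def
      evR_def coevR_def rdual_zigzag rdual_zigzag')

lemma dual_pairing_ldual: "X \<in> Obj C \<Longrightarrow> dual_pairing k C (ldual C X) X (evL X) (coevL X)"
  by unfold_locales
    (simp_all, simp_all add: cmp_def tns_def ident_def asc_def asc'_def lun_def lun'_def run_def run'_def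
      evL_def coevL_def ldual_zigzag ldual_zigzag')

abbreviation "rcounit X V \<equiv> counit X (rdual C X) (evR X) V"
abbreviation "radjunct X W g \<equiv> adjunct X (rdual C X) (coevR X) W g"
abbreviation "rmate X B g \<equiv> mate X (rdual C X) (coevR X) B g"

lemmas rcounit_type [simp] = dual_pairing.counit_type [OF dual_pairing_rdual]
lemmas radjunct_type [simp] = dual_pairing.adjunct_type [OF dual_pairing_rdual]
lemmas rmate_type [simp] = dual_pairing.mate_type [OF dual_pairing_rdual]
lemmas rcounit_nat = dual_pairing.counit_nat [OF dual_pairing_rdual]
lemmas rcounit_tensor = dual_pairing.counit_tensor [OF dual_pairing_rdual]
lemmas rcounit_adjunct = dual_pairing.counit_adjunct [OF dual_pairing_rdual]
lemmas rcounit_inject = dual_pairing.counit_inject [OF dual_pairing_rdual]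
lemmas rcounit_slide = dual_pairing.counit_slide [OF dual_pairing_rdual]
lemmas rpairing_mate = dual_pairing.pairing_mate [OF dual_pairing_rdual]
lemmas rpairing_inject = dual_pairing.pairing_inject [OF dual_pairing_rdual]

text \<open>
  Typed counterparts of \<open>*f\<close>, of the identification \<open>X \<rightarrow> *(X*)\<close>, of the left action on \<open>*M\<close> and of \<open>\<phi>\<^sup>l\<close> with
  its inverse. The arrow \<open>tensor_pairing X Y\<close> is the nested evaluation \<open>(X \<otimes> Y) \<otimes> (*Y \<otimes> *X) \<rightarrow> 1\<close>, of which
  \<open>\<phi>\<^sup>l\<close> is the comparison with the evaluation of \<open>X \<otimes> Y\<close>.
\<close>

definition "dual_arrow f = rmate (src f) (rdual C (tgt f)) (evR (tgt f) \<bullet> (f \<boxtimes> \<iota> (rdual C (tgt f))))"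
definition "double_dual X = rmate (ldual C X) X (evL X)"
definition "dual_action B M r = rmate M (B \<Otimes> rdual C M) (evR M \<bullet> (r \<boxtimes> \<iota> (rdual C M)) \<bullet> asc' M B (rdual C M))"
definition "phi X Y = radjunct Y (rdual C (X \<Otimes> Y))
   (rmate X (Y \<Otimes> rdual C (X \<Otimes> Y)) (evR (X \<Otimes> Y) \<bullet> asc' X Y (rdual C (X \<Otimes> Y))))"
definition "phi' X Y = TA (rdual C Y \<Otimes> rdual C X) (phi_l_inv C X Y) (rdual C (X \<Otimes> Y))"
definition "tensor_pairing X Y = evR X \<bullet> (\<iota> X \<boxtimes> rcounit Y (rdual C X)) \<bullet> asc X Y (rdual C Y \<Otimes> rdual C X)"

lemma adjunct_raw:
  "TA W (rtranspose C X W g) (rdual C X \<Otimes> V) = radjunct X W (TA (X \<Otimes> W) g V)"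
  by (simp add: adjunct_def rtranspose_def cmp_def tns_def ident_def asc_def lun'_def coevR_def)

lemma mate_raw:
  "TA W (RUnit C (rdual C X) \<cdot> rtranspose C X W g) (rdual C X) = rmate X W (TA (X \<Otimes> W) g \<I>)"
  by (simp add: mate_def adjunct_raw[symmetric] cmp_def run_def)

lemma dual_arrow_raw: "TA (rdual C N) (rdual_arr C M N f) (rdual C M) = dual_arrow (TA M f N)"
  by (simp add: rdual_arr_def mate_raw dual_arrow_def) (simp add: cmp_def tns_def ident_def evR_def)

lemma double_dual_raw: "TA X (rdual_ldual C X) (rdual C (ldual C X)) = double_dual X"
  by (simp add: rdual_ldual_def mate_raw double_dual_def evL_def)

lemma dual_action_raw:
  "TA (AObj A \<Otimes> rdual C M) (rdual_action C A M r) (rdual C M) = dual_action (AObj A) M (TA (M \<Otimes> AObj A) r M)"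
  by (simp add: rdual_action_def mate_raw dual_action_def) (simp add: cmp_def tns_def ident_def evR_def asc'_def)

lemma phi_raw: "TA (rdual C (X \<Otimes> Y)) (phi_l C X Y) (rdual C Y \<Otimes> rdual C X) = phi X Y"
  by (simp add: phi_l_def Let_def adjunct_raw mate_raw phi_def)
   (simp add: adjunct_raw mate_raw[symmetric] phi_def cmp_def evR_def asc'_def)

lemma phi_type [simp]:
  "X \<in> Obj C \<Longrightarrow> Y \<in> Obj C \<Longrightarrow> arrow (phi X Y)"
  "X \<in> Obj C \<Longrightarrow> Y \<in> Obj C \<Longrightarrow> src (phi X Y) = rdual C (X \<Otimes> Y)" 
  "X \<in> Obj C \<Longrightarrow> Y \<in> Obj C \<Longrightarrow> tgt (phi X Y) = rdual C Y \<Otimes> rdual C X"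
  by (simp_all add: phi_def)

lemma tensor_pairing_type [simp]:
  "X \<in> Obj C \<Longrightarrow> Y \<in> Obj C \<Longrightarrow> arrow (tensor_pairing X Y)"
  "src (tensor_pairing X Y) = (X \<Otimes> Y) \<Otimes> rdual C Y \<Otimes> rdual C X"
  "tgt (tensor_pairing X Y) = \<I>"
  by (simp_all add: tensor_pairing_def)

lemma tensor_pairing_slide:
  assumes [simp]: "X \<in> Obj C" "Y \<in> Obj C" "arrow d" "tgt d = rdual C Y \<Otimes> rdual C X" and "src d = B"
  shows "tensor_pairing X Y \<bullet> (\<iota> (X \<Otimes> Y) \<boxtimes> d)
    = evR X \<bullet> (\<iota> X \<boxtimes> (rcounit Y (rdual C X) \<bullet> (\<iota> Y \<boxtimes> d))) \<bullet> asc X Y B"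
proof -
  have [simp]: "B \<in> Obj C" "src d = B" using assms by auto
  have "asc X Y (rdual C Y \<Otimes> rdual C X) \<bullet> (\<iota> (X \<Otimes> Y) \<boxtimes> d) = (\<iota> X \<boxtimes> (\<iota> Y \<boxtimes> d)) \<bullet> asc X Y B"
    using asc_nat[of "\<iota> X" "\<iota> Y" d X Y B X Y "rdual C Y \<Otimes> rdual C X"] by simp
  then show ?thesis by (simp add: tensor_pairing_def interchange_reassoc)
qed

text \<open>
  This property determines \<open>\<phi>\<^sup>l\<close>; it is obtained by undoing the two transpositions in its definition.
\<close>

lemma tensor_pairing_phi:
  assumes [simp]: "X \<in> Obj C" "Y \<in> Obj C"
  shows "tensor_pairing X Y \<bullet> (\<iota> (X \<Otimes> Y) \<boxtimes> phi X Y) = evR (X \<Otimes> Y)"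
  by (simp add: tensor_pairing_slide[where B = "rdual C (X \<Otimes> Y)"])
     (simp add: phi_def rcounit_adjunct rpairing_mate[THEN reassoc])

lemma tensor_pairing_inject:
  assumes "tensor_pairing X Y \<bullet> (\<iota> (X \<Otimes> Y) \<boxtimes> d) = tensor_pairing X Y \<bullet> (\<iota> (X \<Otimes> Y) \<boxtimes> d')"
    and [simp]: "X \<in> Obj C" "Y \<in> Obj C" "arrow d" "arrow d'" "tgt d = rdual C Y \<Otimes> rdual C X"
      "tgt d' = rdual C Y \<Otimes> rdual C X" and "src d = B" "src d' = B"
  shows "d = d'"
proof -
  have [simp]: "B \<in> Obj C" "src d = B" "src d' = B" using assms by auto
  let ?f = "\<lambda>d. rcounit Y (rdual C X) \<bullet> (\<iota> Y \<boxtimes> d)"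
  have "(evR X \<bullet> (\<iota> X \<boxtimes> ?f d)) \<bullet> asc X Y B = (evR X \<bullet> (\<iota> X \<boxtimes> ?f d')) \<bullet> asc X Y B"
    using assms(1) by (simp add: tensor_pairing_slide)
  then have "evR X \<bullet> (\<iota> X \<boxtimes> ?f d) = evR X \<bullet> (\<iota> X \<boxtimes> ?f d')"
    by (rule cancel_right[where b' = "asc' X Y B"]) simp_all
  then have "?f d = ?f d'" by (rule rpairing_inject[rotated]) simp_all
  then show ?thesis by (rule rcounit_inject[rotated]) simp_all
qed

text \<open>
  Both pairings of \<open>X \<otimes> Y\<close>, with \<open>*(X \<otimes> Y)\<close> and with \<open>*Y \<otimes> *X\<close>, are nondegenerate. The mate of the nested
  one is therefore inverse to \<open>\<phi>\<^sup>l\<close>, since either composite preserves a nondegenerate pairing. As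
  \<open>phi_l_inv\<close> is a definite description, its properties depend on the existence of this inverse.
\<close>

lemma phi_inverse:
  assumes [simp]: "X \<in> Obj C" "Y \<in> Obj C"
  shows "arrow (phi' X Y)" "phi X Y \<bullet> phi' X Y = \<iota> (rdual C Y \<Otimes> rdual C X)"
proof -
  define \<psi> where "\<psi> = rmate (X \<Otimes> Y) (rdual C Y \<Otimes> rdual C X) (tensor_pairing X Y)"
  have \<psi>_type [simp]: "arrow \<psi>" "src \<psi> = rdual C Y \<Otimes> rdual C X" "tgt \<psi> = rdual C (X \<Otimes> Y)"
    by (simp_all add: \<psi>_def)
  have \<psi>: "evR (X \<Otimes> Y) \<bullet> (\<iota> (X \<Otimes> Y) \<boxtimes> \<psi>) = tensor_pairing X Y"
    by (simp add: \<psi>_def rpairing_mate)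
  have split: "\<iota> (X \<Otimes> Y) \<boxtimes> (f \<bullet> g) = (\<iota> (X \<Otimes> Y) \<boxtimes> f) \<bullet> (\<iota> (X \<Otimes> Y) \<boxtimes> g)"
    if "arrow f" "arrow g" "src f = tgt g" for f g using that by (simp add: interchange)
  have 1: "\<psi> \<bullet> phi X Y = \<iota> (rdual C (X \<Otimes> Y))"
    by (rule rpairing_inject[OF tensor_obj'[OF assms]])
      (simp_all add: split \<psi>[THEN reassoc] tensor_pairing_phi)
  have 2: "phi X Y \<bullet> \<psi> = \<iota> (rdual C Y \<Otimes> rdual C X)"
    by (rule tensor_pairing_inject)
      (simp_all add: split \<psi> tensor_pairing_phi[THEN reassoc])
  have "phi_l C X Y = raw (phi X Y)" by (simp add: phi_raw[symmetric])
  moreover have "arrow (phi X Y)" by simp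
  ultimately have "inverse_arrows C (rdual C (X \<Otimes> Y)) (rdual C Y \<Otimes> rdual C X) (phi_l C X Y) (raw \<psi>)"
    using 1 2 \<psi>_type unfolding inverse_arrows_def arrow_def by (simp add: cmp_def ident_def)
  then have "inverse_arrows C (rdual C (X \<Otimes> Y)) (rdual C Y \<Otimes> rdual C X) (phi_l C X Y) (phi_l_inv C X Y)"
    unfolding phi_l_inv_def by (intro Inv_inverse) (auto simp: iso_arrow_def)
  then show "arrow (phi' X Y)" "phi X Y \<bullet> phi' X Y = \<iota> (rdual C Y \<Otimes> rdual C X)"
    by (simp_all add: inverse_arrows_def arrow_def phi'_def phi_raw[symmetric] cmp_def ident_def del: arrow_obj)
qed

lemma phi'_type [simp]:
  "X \<in> Obj C \<Longrightarrow> Y \<in> Obj C \<Longrightarrow> arrow (phi' X Y)"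
  "src (phi' X Y) = rdual C Y \<Otimes> rdual C X" "tgt (phi' X Y) = rdual C (X \<Otimes> Y)"
  by (fact phi_inverse) (simp_all add: phi'_def)

lemma pairing_phi':
  assumes [simp]: "X \<in> Obj C" "Y \<in> Obj C"
  shows "evR (X \<Otimes> Y) \<bullet> (\<iota> (X \<Otimes> Y) \<boxtimes> phi' X Y) = tensor_pairing X Y"
  by (simp add: tensor_pairing_phi[symmetric] interchange phi_inverse)

section \<open>Transposing arrows into \<open>*M \<otimes> V\<close>\<close>

text \<open>
  The arrow \<open>M \<otimes> E \<rightarrow> V\<close> that corresponds to \<open>\<xi> : E \<rightarrow> *M \<otimes> V\<close>.
\<close>

definition "untranspose M V \<xi> = rcounit M V \<bullet> (\<iota> M \<boxtimes> \<xi>)"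

lemma untranspose_type [simp]:
  "M \<in> Obj C \<Longrightarrow> V \<in> Obj C \<Longrightarrow> arrow \<xi> \<Longrightarrow> tgt \<xi> = rdual C M \<Otimes> V \<Longrightarrow> arrow (untranspose M V \<xi>)"
  "src (untranspose M V \<xi>) = M \<Otimes> src \<xi>" "M \<in> Obj C \<Longrightarrow> tgt (untranspose M V \<xi>) = V"
  by (simp_all add: untranspose_def)

lemma untranspose_inject:
  assumes "untranspose M V \<xi> = untranspose M V \<xi>'" "M \<in> Obj C" "V \<in> Obj C" "arrow \<xi>" "arrow \<xi>'"
   "tgt \<xi> = rdual C M \<Otimes> V" "tgt \<xi>' = rdual C M \<Otimes> V" "src \<xi> = src \<xi>'"
  shows "\<xi> = \<xi>'"
  using assms rcounit_inject unfolding untranspose_def by blast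

lemma untranspose_radjunct:
  assumes "M \<in> Obj C" "W \<in> Obj C" "arrow g" "src g = M \<Otimes> W" "tgt g = V"
  shows "untranspose M V (radjunct M W g) = g"
  using assms unfolding untranspose_def by (intro rcounit_adjunct) auto

lemma untranspose_comp:
  assumes "M \<in> Obj C" "V \<in> Obj C" "arrow \<xi>" "tgt \<xi> = rdual C M \<Otimes> V" "arrow h" "src \<xi> = tgt h"
  shows "untranspose M V (\<xi> \<bullet> h) = untranspose M V \<xi> \<bullet> (\<iota> M \<boxtimes> h)"
  using assms by (simp add: untranspose_def interchange)

lemma untranspose_post:
  assumes [simp]: "M \<in> Obj C" "arrow \<xi>" "tgt \<xi> = rdual C M \<Otimes> V" "arrow v" and v: "src v = V" "tgt v = V'"
  shows "untranspose M V' ((\<iota> (rdual C M) \<boxtimes> v) \<bullet> \<xi>) = v \<bullet> untranspose M V \<xi>"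
proof -
  have [simp]: "V \<in> Obj C" "V' \<in> Obj C" "src v = V" "tgt v = V'" using v assms(4) by auto
  have "untranspose M V' ((\<iota> (rdual C M) \<boxtimes> v) \<bullet> \<xi>)
    = rcounit M V' \<bullet> (\<iota> M \<boxtimes> (\<iota> (rdual C M) \<boxtimes> v)) \<bullet> (\<iota> M \<boxtimes> \<xi>)"
    by (simp add: untranspose_def interchange)
  also have "\<dots> = v \<bullet> untranspose M V \<xi>" by (simp add: untranspose_def rcounit_nat[THEN reassoc])
  finally show ?thesis .
qed

lemma untranspose_pre:
  assumes [simp]: "M \<in> Obj C" "V \<in> Obj C" "arrow \<zeta>" "arrow d" "tgt \<zeta> = B \<Otimes> V" "tgt d = rdual C M"
   and "src d = B"
  shows "untranspose M V ((d \<boxtimes> \<iota> V) \<bullet> \<zeta>) = lun V \<bullet> ((evR M \<bullet> (\<iota> M \<boxtimes> d)) \<boxtimes> \<iota> V) \<bullet> asc' M B V \<bullet> (\<iota> M \<boxtimes> \<zeta>)"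
proof -
  have [simp]: "B \<in> Obj C" "src d = B" using assms by auto
  have "untranspose M V ((d \<boxtimes> \<iota> V) \<bullet> \<zeta>) = rcounit M V \<bullet> (\<iota> M \<boxtimes> (d \<boxtimes> \<iota> V)) \<bullet> (\<iota> M \<boxtimes> \<zeta>)"
    by (simp add: untranspose_def interchange)
  then show ?thesis by (simp add: rcounit_slide[THEN reassoc])
qed

lemma dual_arrow_type [simp]:
  assumes "arrow f"
  shows "arrow (dual_arrow f)" "src (dual_arrow f) = rdual C (tgt f)" "tgt (dual_arrow f) = rdual C (src f)"
  using assms by (simp_all add: dual_arrow_def)

lemma pairing_dual_arrow:
  assumes [simp]: "arrow f" and f: "src f = M" "tgt f = N"
  shows "evR M \<bullet> (\<iota> M \<boxtimes> dual_arrow f) = evR N \<bullet> (f \<boxtimes> \<iota> (rdual C N))"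
  unfolding f[symmetric] dual_arrow_def by (rule rpairing_mate) simp_all

lemma untranspose_dual_arrow:
  assumes [simp]: "V \<in> Obj C" "arrow \<xi>" "tgt \<xi> = rdual C N \<Otimes> V" "arrow f"
   and f: "src f = M" "tgt f = N" and "src \<xi> = E"
  shows "untranspose M V ((dual_arrow f \<boxtimes> \<iota> V) \<bullet> \<xi>) = untranspose N V \<xi> \<bullet> (f \<boxtimes> \<iota> E)"
proof -
  have [simp]: "M \<in> Obj C" "N \<in> Obj C" "E \<in> Obj C" "src f = M" "tgt f = N" "src \<xi> = E" using assms by auto
  have "untranspose M V ((dual_arrow f \<boxtimes> \<iota> V) \<bullet> \<xi>)
    = lun V \<bullet> ((evR N \<bullet> (f \<boxtimes> \<iota> (rdual C N))) \<boxtimes> \<iota> V) \<bullet> asc' M (rdual C N) V \<bullet> (\<iota> M \<boxtimes> \<xi>)"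
    by (simp add: untranspose_pre pairing_dual_arrow)
  also have "\<dots> = lun V \<bullet> (evR N \<boxtimes> \<iota> V) \<bullet> ((f \<boxtimes> \<iota> (rdual C N)) \<boxtimes> \<iota> V) \<bullet> asc' M (rdual C N) V \<bullet> (\<iota> M \<boxtimes> \<xi>)"
    by (simp add: interchange_reassoc)
  also have "\<dots> = lun V \<bullet> (evR N \<boxtimes> \<iota> V) \<bullet> asc' N (rdual C N) V \<bullet> (f \<boxtimes> (\<iota> (rdual C N) \<boxtimes> \<iota> V)) \<bullet> (\<iota> M \<boxtimes> \<xi>)"
    by (simp add: asc'_nat_reassoc[where X = M] del: tns_ident)
  also have "\<dots> = untranspose N V \<xi> \<bullet> (f \<boxtimes> \<iota> E)"
    by (simp add: untranspose_def counit_def interchange)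
  finally show ?thesis .
qed

lemma dual_arrow_ident:
  assumes [simp]: "M \<in> Obj C" shows "dual_arrow (\<iota> M) = \<iota> (rdual C M)"
  by (rule rpairing_inject[OF assms]) (simp_all add: pairing_dual_arrow[where N = M])

text \<open>
  The left action on \<open>*M\<close> pairs with \<open>M\<close> as the right action of \<open>M\<close> does, so after transposition \<open>A\<close> acts on
  \<open>M\<close> from the right.
\<close>

lemma untranspose_dual_action:
  assumes [simp]: "M \<in> Obj C" "B \<in> Obj C" "V \<in> Obj C" "arrow r" "src r = M \<Otimes> B" "tgt r = M"
    "arrow \<xi>" "tgt \<xi> = rdual C M \<Otimes> V" and "src \<xi> = E"
  shows "untranspose M V ((dual_action B M r \<boxtimes> \<iota> V) \<bullet> asc' B (rdual C M) V \<bullet> (\<iota> B \<boxtimes> \<xi>))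
    = untranspose M V \<xi> \<bullet> (r \<boxtimes> \<iota> E) \<bullet> asc' M B E"
proof -
  have [simp]: "E \<in> Obj C" "src \<xi> = E" using assms by auto
  let ?D = "rdual C M"
  have d: "evR M \<bullet> (\<iota> M \<boxtimes> dual_action B M r) = evR M \<bullet> (r \<boxtimes> \<iota> ?D) \<bullet> asc' M B ?D"
    and [simp]: "arrow (dual_action B M r)" "src (dual_action B M r) = B \<Otimes> ?D" "tgt (dual_action B M r) = ?D"
    by (simp_all add: dual_action_def rpairing_mate)
  have "untranspose M V ((dual_action B M r \<boxtimes> \<iota> V) \<bullet> asc' B ?D V \<bullet> (\<iota> B \<boxtimes> \<xi>))
    = lun V \<bullet> ((evR M \<bullet> (r \<boxtimes> \<iota> ?D) \<bullet> asc' M B ?D) \<boxtimes> \<iota> V) \<bullet> asc' M (B \<Otimes> ?D) V \<bullet> (\<iota> M \<boxtimes> (asc' B ?D V \<bullet> (\<iota> B \<boxtimes> \<xi>)))"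
    by (simp add: untranspose_pre[where B = "B \<Otimes> ?D"] d)
  also have "\<dots> = lun V \<bullet> (evR M \<boxtimes> \<iota> V) \<bullet> ((r \<boxtimes> \<iota> ?D) \<boxtimes> \<iota> V) \<bullet>
      ((asc' M B ?D \<boxtimes> \<iota> V) \<bullet> asc' M (B \<Otimes> ?D) V \<bullet> (\<iota> M \<boxtimes> asc' B ?D V)) \<bullet> (\<iota> M \<boxtimes> (\<iota> B \<boxtimes> \<xi>))"
    by (simp add: interchange interchange_reassoc)
  also have "(asc' M B ?D \<boxtimes> \<iota> V) \<bullet> asc' M (B \<Otimes> ?D) V \<bullet> (\<iota> M \<boxtimes> asc' B ?D V) = asc' (M \<Otimes> B) ?D V \<bullet> asc' M B (?D \<Otimes> V)"
    by (rule pentagon_inv) simp_all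
  also have "lun V \<bullet> (evR M \<boxtimes> \<iota> V) \<bullet> ((r \<boxtimes> \<iota> ?D) \<boxtimes> \<iota> V) \<bullet> (asc' (M \<Otimes> B) ?D V \<bullet> asc' M B (?D \<Otimes> V)) \<bullet> (\<iota> M \<boxtimes> (\<iota> B \<boxtimes> \<xi>))
    = lun V \<bullet> (evR M \<boxtimes> \<iota> V) \<bullet> ((r \<boxtimes> \<iota> ?D) \<boxtimes> \<iota> V) \<bullet> asc' (M \<Otimes> B) ?D V \<bullet> ((\<iota> M \<boxtimes> \<iota> B) \<boxtimes> \<xi>) \<bullet> asc' M B E"
    by (simp add: asc'_nat[where Z = E] del: tns_ident)
  also have "\<dots> = lun V \<bullet> (evR M \<boxtimes> \<iota> V) \<bullet> asc' M ?D V \<bullet> (r \<boxtimes> (\<iota> ?D \<boxtimes> \<iota> V)) \<bullet> ((\<iota> M \<boxtimes> \<iota> B) \<boxtimes> \<xi>) \<bullet> asc' M B E"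
    by (simp add: asc'_nat_reassoc[where X = "M \<Otimes> B"] del: tns_ident)
  also have "\<dots> = untranspose M V \<xi> \<bullet> (r \<boxtimes> \<iota> E) \<bullet> asc' M B E"
    by (simp add: untranspose_def counit_def interchange_reassoc)
  finally show ?thesis .
qed

lemma untranspose_right_action:
  assumes [simp]: "M \<in> Obj C" "B \<in> Obj C" "V \<in> Obj C" "arrow s" "src s = V \<Otimes> B" "tgt s = V"
    "arrow \<xi>" "tgt \<xi> = rdual C M \<Otimes> V" and "src \<xi> = E"
  shows "untranspose M V ((\<iota> (rdual C M) \<boxtimes> s) \<bullet> asc (rdual C M) V B \<bullet> (\<xi> \<boxtimes> \<iota> B))
    = s \<bullet> (untranspose M V \<xi> \<boxtimes> \<iota> B) \<bullet> asc' M E B"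
proof -
  have [simp]: "E \<in> Obj C" "src \<xi> = E" using assms by auto
  let ?D = "rdual C M"
  have "untranspose M V ((\<iota> ?D \<boxtimes> s) \<bullet> asc ?D V B \<bullet> (\<xi> \<boxtimes> \<iota> B))
    = s \<bullet> untranspose M (V \<Otimes> B) (asc ?D V B \<bullet> (\<xi> \<boxtimes> \<iota> B))"
    by (rule untranspose_post) simp_all
  also have "\<dots> = s \<bullet> rcounit M (V \<Otimes> B) \<bullet> (\<iota> M \<boxtimes> asc ?D V B) \<bullet> (\<iota> M \<boxtimes> (\<xi> \<boxtimes> \<iota> B))"
    by (simp add: untranspose_def interchange)
  also have "\<dots> = s \<bullet> (rcounit M V \<boxtimes> \<iota> B) \<bullet> asc' M (?D \<Otimes> V) B \<bullet> (\<iota> M \<boxtimes> (\<xi> \<boxtimes> \<iota> B))"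
    by (simp add: rcounit_tensor[THEN reassoc])
  also have "\<dots> = s \<bullet> (untranspose M V \<xi> \<boxtimes> \<iota> B) \<bullet> asc' M E B"
    by (simp add: asc'_nat interchange_reassoc untranspose_def)
  finally show ?thesis .
qed

section \<open>The pre-balancing under transposition\<close>

abbreviation "lcounit X V \<equiv> counit (ldual C X) X (evL X) V"

lemmas lcounit_type [simp] = dual_pairing.counit_type [OF dual_pairing_ldual]
lemmas lcounit_inject = dual_pairing.counit_inject [OF dual_pairing_ldual]

lemma double_dual_type [simp]:
  assumes "X \<in> Obj C"
  shows "arrow (double_dual X)" "src (double_dual X) = X" "tgt (double_dual X) = rdual C (ldual C X)"
  using assms by (simp_all add: double_dual_def)

lemma pairing_double_dual:
  "X \<in> Obj C \<Longrightarrow> evR (ldual C X) \<bullet> (\<iota> (ldual C X) \<boxtimes> double_dual X) = evL X"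
  by (simp add: double_dual_def rpairing_mate)

text \<open>
  The arrow of duals underlying the pre-balancing, followed by the dual of \<open>a\<close>. The inverse of \<open>\<phi>\<^sup>l\<close> turns the
  evaluation of \<open>X* \<otimes> N\<close> into the nested one, and the identification of \<open>X\<close> with \<open>*(X*)\<close> turns the outer
  evaluation into that of \<open>X\<close>.
\<close>

lemma pairing_balancing:
  assumes [simp]: "X \<in> Obj C" "N \<in> Obj C" "arrow a" and a: "src a = Z" "tgt a = ldual C X \<Otimes> N"
  shows "evR Z \<bullet> (\<iota> Z \<boxtimes> (dual_arrow a \<bullet> phi' (ldual C X) N \<bullet> (\<iota> (rdual C N) \<boxtimes> double_dual X)))
    = evL X \<bullet> (\<iota> (ldual C X) \<boxtimes> rcounit N X) \<bullet> asc (ldual C X) N (rdual C N \<Otimes> X)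
        \<bullet> (a \<boxtimes> \<iota> (rdual C N \<Otimes> X))"
proof -
  let ?Y = "ldual C X" let ?D = "rdual C N"
  have [simp]: "Z \<in> Obj C" "src a = Z" "tgt a = ?Y \<Otimes> N" using a assms(3) by auto
  let ?p = "phi' ?Y N \<bullet> (\<iota> ?D \<boxtimes> double_dual X)"
  have "evR Z \<bullet> (\<iota> Z \<boxtimes> (dual_arrow a \<bullet> ?p)) = evR Z \<bullet> (\<iota> Z \<boxtimes> dual_arrow a) \<bullet> (\<iota> Z \<boxtimes> ?p)"
    by (simp add: interchange)
  also have "\<dots> = evR (?Y \<Otimes> N) \<bullet> (a \<boxtimes> \<iota> (rdual C (?Y \<Otimes> N))) \<bullet> (\<iota> Z \<boxtimes> ?p)"
    by (simp add: pairing_dual_arrow[where N = "?Y \<Otimes> N", THEN reassoc])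
  also have "\<dots> = evR (?Y \<Otimes> N) \<bullet> (\<iota> (?Y \<Otimes> N) \<boxtimes> phi' ?Y N) \<bullet> (\<iota> (?Y \<Otimes> N) \<boxtimes> (\<iota> ?D \<boxtimes> double_dual X)) \<bullet> (a \<boxtimes> \<iota> (?D \<Otimes> X))"
    by (simp add: interchange_reassoc interchange)
  also have "\<dots> = (tensor_pairing ?Y N \<bullet> (\<iota> (?Y \<Otimes> N) \<boxtimes> (\<iota> ?D \<boxtimes> double_dual X))) \<bullet> (a \<boxtimes> \<iota> (?D \<Otimes> X))"
    by (simp add: pairing_phi'[THEN reassoc])
  also have "\<dots> = evR ?Y \<bullet> (\<iota> ?Y \<boxtimes> (double_dual X \<bullet> rcounit N X)) \<bullet> asc ?Y N (?D \<Otimes> X) \<bullet> (a \<boxtimes> \<iota> (?D \<Otimes> X))"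
    by (simp add: tensor_pairing_slide[where B = "?D \<Otimes> X"] rcounit_nat[where V = X])
  also have "\<dots> = evR ?Y \<bullet> (\<iota> ?Y \<boxtimes> double_dual X) \<bullet> (\<iota> ?Y \<boxtimes> rcounit N X) \<bullet> asc ?Y N (?D \<Otimes> X) \<bullet> (a \<boxtimes> \<iota> (?D \<Otimes> X))"
    by (simp add: interchange_reassoc)
  also have "\<dots> = evL X \<bullet> (\<iota> ?Y \<boxtimes> rcounit N X) \<bullet> asc ?Y N (?D \<Otimes> X) \<bullet> (a \<boxtimes> \<iota> (?D \<Otimes> X))"
    by (simp add: pairing_double_dual[THEN reassoc])
  finally show ?thesis .
qed

definition "balancing X M N = (phi' (ldual C X) M \<boxtimes> \<iota> N) \<bullet> ((\<iota> (rdual C M) \<boxtimes> double_dual X) \<boxtimes> \<iota> N)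
   \<bullet> asc' (rdual C M) X N"

text \<open>
  The dual of the associator and the pre-balancing are combined into one arrow between duals, whose pairing
  is known by \<open>pairing_balancing\<close>. The pentagon and \<open>counit_tensor\<close> then collect the evaluation of \<open>X \<otimes> M\<close> around \<open>\<xi>\<close>, which
  becomes the transpose of \<open>\<xi>\<close>, and leave the evaluation of \<open>X\<close> outside.
\<close>

lemma untranspose_balancing:
  assumes [simp]: "X \<in> Obj C" "M \<in> Obj C" "arrow \<xi>"
      "tgt \<xi> = rdual C (X \<Otimes> M) \<Otimes> (X \<Otimes> M)" and "src \<xi> = E"
  shows "untranspose ((ldual C X \<Otimes> X) \<Otimes> M) M
      ((dual_arrow (asc (ldual C X) X M) \<boxtimes> \<iota> M) \<bullet> balancing X (X \<Otimes> M) M \<bullet> \<xi>)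
    = lcounit X M \<bullet> (\<iota> (ldual C X) \<boxtimes> untranspose (X \<Otimes> M) (X \<Otimes> M) \<xi>)
        \<bullet> asc (ldual C X) (X \<Otimes> M) E \<bullet> (asc (ldual C X) X M \<boxtimes> \<iota> E)"
proof -
  define Y N where "Y = ldual C X" and "N = X \<Otimes> M"
  define D Z where "D = rdual C N" and "Z = (Y \<Otimes> X) \<Otimes> M"
  define a where "a = asc Y X M"
  have [simp]: "Y \<in> Obj C" "N \<in> Obj C" "D \<in> Obj C" "Z \<in> Obj C" "E \<in> Obj C" "src \<xi> = E" "tgt \<xi> = D \<Otimes> N"
    "rdual C N = D" "ldual C X = Y" "arrow a" "src a = Z" "tgt a = Y \<Otimes> N"
    and t: "arrow (double_dual X)" "src (double_dual X) = X" "tgt (double_dual X) = rdual C Y"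
    using assms double_dual_type[of X] by (auto simp: Y_def N_def D_def Z_def a_def)
  note [simp] = t
  have [simp]: "arrow (counit N D (evR N) V)" "src (counit N D (evR N) V) = N \<Otimes> (D \<Otimes> V)"
    "tgt (counit N D (evR N) V) = V" if "V \<in> Obj C" for V
    using rcounit_type[of N V] that by auto
  have [simp]: "src (evL X) = Y \<Otimes> X" using ev_type(5)[of X] by simp
  have [simp]: "src (phi' Y N) = D \<Otimes> rdual C Y" using phi'_type(2)[of Y N] by simp
  let ?d = "dual_arrow a \<bullet> phi' Y N \<bullet> (\<iota> D \<boxtimes> double_dual X)"
  let ?B = "D \<Otimes> X" and ?\<zeta> = "asc' D X M \<bullet> \<xi>"
  have N [simp]: "X \<Otimes> M = N" by (simp add: N_def)
  have g: "evR Z \<bullet> (\<iota> Z \<boxtimes> ?d) = evL X \<bullet> (\<iota> Y \<boxtimes> rcounit N X) \<bullet> asc Y N ?B \<bullet> (a \<boxtimes> \<iota> ?B)"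
    using pairing_balancing[of X N a Z] by simp
  have [simp]: "tgt (asc' D X M \<bullet> \<xi>) = ?B \<Otimes> M" "arrow ?\<zeta>" by simp_all
  have "untranspose Z M ((dual_arrow a \<boxtimes> \<iota> M) \<bullet> balancing X N M \<bullet> \<xi>) = untranspose Z M ((?d \<boxtimes> \<iota> M) \<bullet> ?\<zeta>)"
    by (simp add: balancing_def interchange_reassoc)
  also have "\<dots> = lun M \<bullet> ((evR Z \<bullet> (\<iota> Z \<boxtimes> ?d)) \<boxtimes> \<iota> M) \<bullet> asc' Z ?B M \<bullet> (\<iota> Z \<boxtimes> ?\<zeta>)"
    by (rule untranspose_pre) simp_all
  also have "\<dots> = lun M \<bullet> (evL X \<boxtimes> \<iota> M) \<bullet> ((\<iota> Y \<boxtimes> rcounit N X) \<boxtimes> \<iota> M) \<bullet> (asc Y N ?B \<boxtimes> \<iota> M)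
      \<bullet> ((a \<boxtimes> \<iota> ?B) \<boxtimes> \<iota> M) \<bullet> asc' Z ?B M \<bullet> (\<iota> Z \<boxtimes> ?\<zeta>)"
    unfolding g by (simp add: interchange_reassoc)
  also have "\<dots> = lun M \<bullet> (evL X \<boxtimes> \<iota> M) \<bullet> ((\<iota> Y \<boxtimes> rcounit N X) \<boxtimes> \<iota> M) \<bullet> (asc Y N ?B \<boxtimes> \<iota> M)
      \<bullet> asc' (Y \<Otimes> N) ?B M \<bullet> (a \<boxtimes> (\<iota> ?B \<boxtimes> \<iota> M)) \<bullet> (\<iota> Z \<boxtimes> ?\<zeta>)"
    by (simp add: asc'_nat_reassoc[where X = Z] del: tns_ident)
  also have "\<dots> = lun M \<bullet> (evL X \<boxtimes> \<iota> M) \<bullet> ((\<iota> Y \<boxtimes> rcounit N X) \<boxtimes> \<iota> M) \<bullet> asc' Y (N \<Otimes> ?B) M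
      \<bullet> (\<iota> Y \<boxtimes> asc' N ?B M) \<bullet> asc Y N (?B \<Otimes> M) \<bullet> ((\<iota> Y \<boxtimes> \<iota> N) \<boxtimes> ?\<zeta>) \<bullet> (a \<boxtimes> \<iota> E)"
    by (simp add: pentagon_mixed'[THEN reassoc] interchange interchange_reassoc)
  also have "\<dots> = lun M \<bullet> (evL X \<boxtimes> \<iota> M) \<bullet> asc' Y X M \<bullet> (\<iota> Y \<boxtimes> (rcounit N X \<boxtimes> \<iota> M))
      \<bullet> (\<iota> Y \<boxtimes> asc' N ?B M) \<bullet> (\<iota> Y \<boxtimes> (\<iota> N \<boxtimes> ?\<zeta>)) \<bullet> asc Y N E \<bullet> (a \<boxtimes> \<iota> E)"
    by (simp add: asc'_nat_reassoc asc_nat_reassoc[where Z = E] del: tns_ident)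
  also have "\<dots> = lun M \<bullet> (evL X \<boxtimes> \<iota> M) \<bullet> asc' Y X M \<bullet> (\<iota> Y \<boxtimes> (((rcounit N X \<boxtimes> \<iota> M)
      \<bullet> asc' N ?B M) \<bullet> (\<iota> N \<boxtimes> ?\<zeta>))) \<bullet> asc Y N E \<bullet> (a \<boxtimes> \<iota> E)"
    by (simp add: interchange_reassoc)
  also have "(rcounit N X \<boxtimes> \<iota> M) \<bullet> asc' N ?B M = rcounit N N \<bullet> (\<iota> N \<boxtimes> asc D X M)"
    using rcounit_tensor[of N X M] by (simp add: N)
  also have "(rcounit N N \<bullet> (\<iota> N \<boxtimes> asc D X M)) \<bullet> (\<iota> N \<boxtimes> ?\<zeta>) = untranspose N N \<xi>"
    by (simp add: untranspose_def interchange N)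
  finally show ?thesis
    by (simp add: counit_def Z_def a_def)
qed

text \<open>
  On \<open>X* \<otimes> X \<otimes> M \<otimes> E\<close>, the evaluation of \<open>X\<close> and \<open>t\<close> act on different factors, so their order is immaterial.
\<close>

lemma lcounit_action:
  assumes [simp]: "X \<in> Obj C" "M \<in> Obj C" "E \<in> Obj C" "arrow t" "src t = M \<Otimes> E" "tgt t = M"
  shows "lcounit X M \<bullet> (\<iota> (ldual C X) \<boxtimes> ((\<iota> X \<boxtimes> t) \<bullet> asc X M E))
        \<bullet> asc (ldual C X) (X \<Otimes> M) E \<bullet> (asc (ldual C X) X M \<boxtimes> \<iota> E)
    = t \<bullet> ((lun M \<bullet> (evL X \<boxtimes> \<iota> M)) \<boxtimes> \<iota> E)"
proof -
  let ?Y = "ldual C X"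
  have "lcounit X M \<bullet> (\<iota> ?Y \<boxtimes> ((\<iota> X \<boxtimes> t) \<bullet> asc X M E)) \<bullet> asc ?Y (X \<Otimes> M) E \<bullet> (asc ?Y X M \<boxtimes> \<iota> E)
    = lcounit X M \<bullet> (\<iota> ?Y \<boxtimes> (\<iota> X \<boxtimes> t)) \<bullet> (\<iota> ?Y \<boxtimes> asc X M E) \<bullet> asc ?Y (X \<Otimes> M) E \<bullet> (asc ?Y X M \<boxtimes> \<iota> E)"
    by (simp add: interchange_reassoc)
  also have "\<dots> = lun M \<bullet> (evL X \<boxtimes> \<iota> M) \<bullet> asc' ?Y X M \<bullet> (\<iota> ?Y \<boxtimes> (\<iota> X \<boxtimes> t)) \<bullet> asc ?Y X (M \<Otimes> E) \<bullet> asc (?Y \<Otimes> X) M E"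
    by (simp add: pentagon_arrows counit_def)
  also have "\<dots> = lun M \<bullet> (evL X \<boxtimes> t) \<bullet> asc (?Y \<Otimes> X) M E"
    by (simp add: asc'_nat_reassoc interchange_reassoc)
  also have "\<dots> = lun M \<bullet> (\<iota> \<I> \<boxtimes> t) \<bullet> (evL X \<boxtimes> (\<iota> M \<boxtimes> \<iota> E)) \<bullet> asc (?Y \<Otimes> X) M E"
    by (simp add: interchange_reassoc)
  also have "\<dots> = t \<bullet> lun (M \<Otimes> E) \<bullet> asc \<I> M E \<bullet> ((evL X \<boxtimes> \<iota> M) \<boxtimes> \<iota> E)"
    by (simp add: lun_nat_reassoc[where X = "M \<Otimes> E"] asc_nat_rev del: tns_ident)
  also have "\<dots> = t \<bullet> ((lun M \<bullet> (evL X \<boxtimes> \<iota> M)) \<boxtimes> \<iota> E)"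
    by (simp add: lun_tensor[THEN reassoc] interchange)
  finally show ?thesis .
qed

text \<open>
  Transposed, the left-hand side of the module-end equation evaluates \<open>X* \<otimes> X\<close> and applies \<open>t\<^sub>M\<close>, while the
  right-hand side applies \<open>t\<^bsub>X \<otimes> M\<^esub>\<close> and then evaluates. By \<open>lcounit_action\<close> the former is also the
  evaluation after \<open>X \<otimes> t\<^sub>M\<close>. As \<open>X* \<otimes> -\<close> is left adjoint to \<open>X \<otimes> -\<close>, evaluation loses no
  information, and the two sides agree exactly when \<open>t\<^bsub>X \<otimes> M\<^esub> = X \<otimes> t\<^sub>M\<close>.
\<close>

lemma balancing_iff:
  assumes [simp]: "X \<in> Obj C" "M \<in> Obj C" "arrow \<xi>" "arrow \<xi>'" "tgt \<xi> = rdual C M \<Otimes> M"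
      "tgt \<xi>' = rdual C (X \<Otimes> M) \<Otimes> (X \<Otimes> M)" and "src \<xi> = E" "src \<xi>' = E"
  shows "(dual_arrow (lun M \<bullet> (evL X \<boxtimes> \<iota> M)) \<boxtimes> \<iota> M) \<bullet> \<xi>
      = (dual_arrow (asc (ldual C X) X M) \<boxtimes> \<iota> M) \<bullet> balancing X (X \<Otimes> M) M \<bullet> \<xi>'
    \<longleftrightarrow> untranspose (X \<Otimes> M) (X \<Otimes> M) \<xi>' = (\<iota> X \<boxtimes> untranspose M M \<xi>) \<bullet> asc X M E" (is "?l = ?r \<longleftrightarrow> ?u = ?v")
proof -
  let ?Y = "ldual C X"
  let ?Z = "(?Y \<Otimes> X) \<Otimes> M"
  have [simp]: "E \<in> Obj C" "src \<xi> = E" "src \<xi>' = E" using assms by auto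
  have type [simp]: "arrow ?l" "arrow ?r" "tgt ?l = rdual C ?Z \<Otimes> M" "tgt ?r = rdual C ?Z \<Otimes> M"
    "src ?l = E" "src ?r = E" "arrow ?u" "arrow ?v" "tgt ?u = X \<Otimes> M" "tgt ?v = X \<Otimes> M"
    "src ?u = (X \<Otimes> M) \<Otimes> E" "src ?v = (X \<Otimes> M) \<Otimes> E"
    by (simp_all add: balancing_def)
  let ?b = "asc ?Y (X \<Otimes> M) E \<bullet> (asc ?Y X M \<boxtimes> \<iota> E)"
  let ?b' = "(asc' ?Y X M \<boxtimes> \<iota> E) \<bullet> asc' ?Y (X \<Otimes> M) E"
  have l: "untranspose ?Z M ?l = lcounit X M \<bullet> (\<iota> ?Y \<boxtimes> ?v) \<bullet> ?b"
    by (simp add: untranspose_dual_arrow[where N = M and E = E] lcounit_action)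
  have r: "untranspose ?Z M ?r = lcounit X M \<bullet> (\<iota> ?Y \<boxtimes> ?u) \<bullet> ?b"
    by (simp add: untranspose_balancing[where E = E])
  have "?l = ?r \<longleftrightarrow> untranspose ?Z M ?l = untranspose ?Z M ?r"
    using untranspose_inject[of ?Z M ?l ?r] type(1-6) by auto
  also have "\<dots> \<longleftrightarrow> (lcounit X M \<bullet> (\<iota> ?Y \<boxtimes> ?v)) \<bullet> ?b = (lcounit X M \<bullet> (\<iota> ?Y \<boxtimes> ?u)) \<bullet> ?b"
    unfolding l r by simp
  also have "\<dots> \<longleftrightarrow> lcounit X M \<bullet> (\<iota> ?Y \<boxtimes> ?v) = lcounit X M \<bullet> (\<iota> ?Y \<boxtimes> ?u)"
  proof
    assume "(lcounit X M \<bullet> (\<iota> ?Y \<boxtimes> ?v)) \<bullet> ?b = (lcounit X M \<bullet> (\<iota> ?Y \<boxtimes> ?u)) \<bullet> ?b"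
    then show "lcounit X M \<bullet> (\<iota> ?Y \<boxtimes> ?v) = lcounit X M \<bullet> (\<iota> ?Y \<boxtimes> ?u)"
      by (rule cancel_right[where b' = ?b']) (simp_all add: interchange_reassoc)
  qed simp
  also have "\<dots> \<longleftrightarrow> ?v = ?u"
    using lcounit_inject[of X M ?v ?u] type(7-12) by auto
  finally show ?thesis by auto
qed

end

section \<open>Modules, bimodules and cones\<close>

locale algebra_in_category = tensor_category k C
  for k :: "'k ring" and C :: "('k, 'o, 'm, 'z) tensor_cat_scheme" (structure) +
  fixes A :: "('o, 'm) alg"
  assumes algebra: "algebra_in C A"
begin

abbreviation "a \<equiv> AObj A"
definition "\<mu> = TA (a \<Otimes> a) (AMult A) a"
definition "\<eta> = TA \<I> (AUnit A) a"
definition "act M r = TA (M \<Otimes> a) r M"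

lemma arrow_TA: "arrow (TA X f Y) \<longleftrightarrow> X \<in> Obj C \<and> Y \<in> Obj C \<and> f \<in> Ar C X Y"
  by (auto simp: arrow_def simp del: arrow_obj)

lemma algebra_type [simp]:
  "a \<in> Obj C" "arrow \<mu>" "src \<mu> = a \<Otimes> a" "tgt \<mu> = a" "arrow \<eta>" "src \<eta> = \<I>" "tgt \<eta> = a"
  "src (act M r) = M \<Otimes> a" "tgt (act M r) = M"
  using algebra by (simp_all add: algebra_in_def \<mu>_def \<eta>_def act_def arrow_TA)

lemma unit_left: "\<mu> \<bullet> (\<eta> \<boxtimes> \<iota> a) = lun a"
  using algebra by (simp add: algebra_in_def \<mu>_def \<eta>_def cmp_def tns_def ident_def lun_def)

lemma right_action_iff:
  "right_action C A M r \<longleftrightarrow> M \<in> Obj C \<and> arrow (act M r) \<and>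
     act M r \<bullet> (act M r \<boxtimes> \<iota> a) = act M r \<bullet> (\<iota> M \<boxtimes> \<mu>) \<bullet> asc M a a \<and>
     act M r \<bullet> (\<iota> M \<boxtimes> \<eta>) = run M"
  using algebra_type(1)
  by (auto simp: right_action_def act_def arrow_TA \<mu>_def \<eta>_def cmp_def tns_def ident_def asc_def run_def)

lemma right_action_regular: "right_action C A a (AMult A)"
  using algebra by (simp add: algebra_in_def right_action_def)

lemma act_regular: "act a (AMult A) = \<mu>"
  by (simp add: act_def \<mu>_def)

lemma act_tensor: "act (X \<Otimes> M) ((Idm C X \<star> r) \<cdot> Assoc C X M a) = (\<iota> X \<boxtimes> act M r) \<bullet> asc X M a"
  by (simp add: act_def cmp_def tns_def ident_def asc_def)

lemma right_action_tensor:
  assumes [simp]: "X \<in> Obj C" and "right_action C A M r"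
  shows "right_action C A (X \<Otimes> M) ((Idm C X \<star> r) \<cdot> Assoc C X M a)"
proof -
  let ?r = "act M r"
  have [simp]: "M \<in> Obj C" "arrow ?r"
    and assoc: "?r \<bullet> (?r \<boxtimes> \<iota> a) = ?r \<bullet> (\<iota> M \<boxtimes> \<mu>) \<bullet> asc M a a" and unit: "?r \<bullet> (\<iota> M \<boxtimes> \<eta>) = run M"
    using assms(2) by (simp_all add: right_action_iff)
  let ?s = "(\<iota> X \<boxtimes> ?r) \<bullet> asc X M a"
  have "?s \<bullet> (?s \<boxtimes> \<iota> a) = (\<iota> X \<boxtimes> ?r) \<bullet> asc X M a \<bullet> ((\<iota> X \<boxtimes> ?r) \<boxtimes> \<iota> a) \<bullet> (asc X M a \<boxtimes> \<iota> a)"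
    by (simp add: interchange)
  also have "\<dots> = (\<iota> X \<boxtimes> (?r \<bullet> (?r \<boxtimes> \<iota> a))) \<bullet> asc X (M \<Otimes> a) a \<bullet> (asc X M a \<boxtimes> \<iota> a)"
    by (simp add: asc_nat_reassoc interchange_reassoc)
  also have "\<dots> = (\<iota> X \<boxtimes> ?r) \<bullet> (\<iota> X \<boxtimes> (\<iota> M \<boxtimes> \<mu>)) \<bullet> (\<iota> X \<boxtimes> asc M a a) \<bullet> asc X (M \<Otimes> a) a \<bullet> (asc X M a \<boxtimes> \<iota> a)"
    by (simp add: assoc interchange_reassoc)
  also have "\<dots> = (\<iota> X \<boxtimes> ?r) \<bullet> (\<iota> X \<boxtimes> (\<iota> M \<boxtimes> \<mu>)) \<bullet> asc X M (a \<Otimes> a) \<bullet> asc (X \<Otimes> M) a a"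
    by (simp add: pentagon_arrows)
  also have "\<dots> = (\<iota> X \<boxtimes> ?r) \<bullet> asc X M a \<bullet> ((\<iota> X \<boxtimes> \<iota> M) \<boxtimes> \<mu>) \<bullet> asc (X \<Otimes> M) a a"
    by (simp add: asc_nat_rev_reassoc del: tns_ident)
  finally have 1: "?s \<bullet> (?s \<boxtimes> \<iota> a) = ?s \<bullet> (\<iota> (X \<Otimes> M) \<boxtimes> \<mu>) \<bullet> asc (X \<Otimes> M) a a"
    by simp
  have "?s \<bullet> ((\<iota> X \<boxtimes> \<iota> M) \<boxtimes> \<eta>) = (\<iota> X \<boxtimes> ?r) \<bullet> (\<iota> X \<boxtimes> (\<iota> M \<boxtimes> \<eta>)) \<bullet> asc X M \<I>"
    by (simp add: asc_nat[where Z = \<I>] del: tns_ident)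
  also have "\<dots> = run (X \<Otimes> M)"
    by (simp add: interchange_reassoc unit run_tensor)
  finally have 2: "?s \<bullet> (\<iota> (X \<Otimes> M) \<boxtimes> \<eta>) = run (X \<Otimes> M)" by simp
  show ?thesis
    unfolding right_action_iff act_tensor using 1 2 by simp
qed

text \<open>
  The component \<open>M \<otimes> E \<rightarrow> M\<close> that corresponds to a component \<open>x : E \<rightarrow> *M \<otimes> M\<close> of a cone.
\<close>

definition "untransposed E x M = untranspose M M (TA E x (rdual C M \<Otimes> M))"

text \<open>
  An arrow is a map of bimodules by two equations between arrows into \<open>*M \<otimes> M\<close>. As transposition is
  injective, each may be compared after transposing.
\<close>

lemma hom_bimod_arrow_iff:
  assumes "right_action C A M r" "E \<in> Obj C" "arrow (TA (a \<Otimes> E) l E)" "arrow (TA (E \<Otimes> a) q E)"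
    "x \<in> Ar C E (rdual C M \<Otimes> M)"
  shows "x \<in> Ar (bimod_cat C A) (E, l, q) (hom_bimod C A (M, r) (M, r)) \<longleftrightarrow>
    untransposed E x M \<bullet> (\<iota> M \<boxtimes> TA (a \<Otimes> E) l E) = untransposed E x M \<bullet> (act M r \<boxtimes> \<iota> E) \<bullet> asc' M a E \<and>
    untransposed E x M \<bullet> (\<iota> M \<boxtimes> TA (E \<Otimes> a) q E) = act M r \<bullet> (untransposed E x M \<boxtimes> \<iota> a) \<bullet> asc' M E a"
    (is "?raw \<longleftrightarrow> ?L \<and> ?R")
proof -
  define D \<xi> where "D = rdual C M" and "\<xi> = TA E x (D \<Otimes> M)"
  define l' q' where "l' = TA (a \<Otimes> E) l E" and "q' = TA (E \<Otimes> a) q E"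
  have [simp]: "M \<in> Obj C" "arrow (act M r)" "E \<in> Obj C" "D \<in> Obj C" "rdual C M = D"
    using assms by (auto simp: right_action_iff D_def)
  have [simp]: "arrow \<xi>" "src \<xi> = E" "tgt \<xi> = D \<Otimes> M" "arrow l'" "src l' = a \<Otimes> E" "tgt l' = E"
    "arrow q'" "src q' = E \<Otimes> a" "tgt q' = E"
    using assms by (simp_all add: \<xi>_def l'_def q'_def arrow_TA)
  let ?d = "dual_action a M (act M r)"
  have [simp]: "arrow ?d" "src ?d = a \<Otimes> D" "tgt ?d = D"
    using rmate_type[of M] by (simp_all add: dual_action_def)
  have untransposed: "untransposed E x M = untranspose M M \<xi>" by (simp add: untransposed_def \<xi>_def)
  have "?raw \<longleftrightarrow> \<xi> \<bullet> l' = ((?d \<boxtimes> \<iota> M) \<bullet> asc' a D M) \<bullet> (\<iota> a \<boxtimes> \<xi>)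
      \<and> \<xi> \<bullet> q' = ((\<iota> D \<boxtimes> act M r) \<bullet> asc D M a) \<bullet> (\<xi> \<boxtimes> \<iota> a)"
    using assms(5)
    by (simp add: bimod_cat_def hom_bimod_def cmp_def tns_def ident_def asc_def asc'_def \<xi>_def l'_def q'_def
       act_def dual_action_raw[symmetric])
  also have "\<xi> \<bullet> l' = ((?d \<boxtimes> \<iota> M) \<bullet> asc' a D M) \<bullet> (\<iota> a \<boxtimes> \<xi>)
     \<longleftrightarrow> untranspose M M (\<xi> \<bullet> l') = untranspose M M ((?d \<boxtimes> \<iota> M) \<bullet> asc' a D M \<bullet> (\<iota> a \<boxtimes> \<xi>))"
    using untranspose_inject[of M M "\<xi> \<bullet> l'" "(?d \<boxtimes> \<iota> M) \<bullet> asc' a D M \<bullet> (\<iota> a \<boxtimes> \<xi>)"] by auto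
  also have "\<dots> \<longleftrightarrow> ?L"
    using untranspose_dual_action[of M a M "act M r" \<xi> E]
    by (simp add: untransposed untranspose_comp l'_def[symmetric])
  also have "\<xi> \<bullet> q' = ((\<iota> D \<boxtimes> act M r) \<bullet> asc D M a) \<bullet> (\<xi> \<boxtimes> \<iota> a)
     \<longleftrightarrow> untranspose M M (\<xi> \<bullet> q') = untranspose M M ((\<iota> D \<boxtimes> act M r) \<bullet> asc D M a \<bullet> (\<xi> \<boxtimes> \<iota> a))"
    using untranspose_inject[of M M "\<xi> \<bullet> q'" "(\<iota> D \<boxtimes> act M r) \<bullet> asc D M a \<bullet> (\<xi> \<boxtimes> \<iota> a)"] by auto
  also have "\<dots> \<longleftrightarrow> ?R"
    using untranspose_right_action[of M a M "act M r" \<xi> E]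
    by (simp add: untransposed untranspose_comp q'_def[symmetric])
  finally show ?thesis .
qed

lemma untransposed_type [simp]:
  "M \<in> Obj C \<Longrightarrow> E \<in> Obj C \<Longrightarrow> x \<in> Ar C E (rdual C M \<Otimes> M) \<Longrightarrow> arrow (untransposed E x M)"
  "src (untransposed E x M) = M \<Otimes> E" "M \<in> Obj C \<Longrightarrow> tgt (untransposed E x M) = M"
  by (simp_all add: untransposed_def arrow_TA)

lemma dinatural_square_iff:
  assumes [simp]: "M \<in> Obj C" "N \<in> Obj C" "E \<in> Obj C" and "f \<in> Ar C M N"
    "x \<in> Ar C E (rdual C M \<Otimes> M)" "y \<in> Ar C E (rdual C N \<Otimes> N)"
  shows "FArr (hom_bifun C A) (M, r) (M, r) (M, r) (N, s) (Idm C M) f \<cdot> x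
       = FArr (hom_bifun C A) (M, r) (N, s) (N, s) (N, s) f (Idm C N) \<cdot> y
    \<longleftrightarrow> TA M f N \<bullet> untransposed E x M = untransposed E y N \<bullet> (TA M f N \<boxtimes> \<iota> E)"
proof -
  let ?f = "TA M f N" and ?x = "TA E x (rdual C M \<Otimes> M)" and ?y = "TA E y (rdual C N \<Otimes> N)"
  have [simp]: "arrow ?f" "arrow ?x" "arrow ?y" using assms by (simp_all add: arrow_TA)
  let ?l = "(dual_arrow (\<iota> M) \<boxtimes> ?f) \<bullet> ?x" and ?r = "(dual_arrow ?f \<boxtimes> \<iota> N) \<bullet> ?y"
  have "FArr (hom_bifun C A) (M, r) (M, r) (M, r) (N, s) (Idm C M) f \<cdot> x
      = FArr (hom_bifun C A) (M, r) (N, s) (N, s) (N, s) f (Idm C N) \<cdot> y \<longleftrightarrow> ?l = ?r"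
    by (simp add: hom_bifun_def cmp_def tns_def ident_def dual_arrow_raw[symmetric])
  also have "\<dots> \<longleftrightarrow> untranspose M N ?l = untranspose M N ?r"
    using untranspose_inject[of M N ?l ?r] by (auto simp: dual_arrow_ident)
  also have "untranspose M N ?l = ?f \<bullet> untransposed E x M"
    by (simp add: dual_arrow_ident untransposed_def untranspose_post)
  also have "untranspose M N ?r = untransposed E y N \<bullet> (?f \<boxtimes> \<iota> E)"
    unfolding untransposed_def by (rule untranspose_dual_arrow) simp_all
  finally show ?thesis .
qed

lemma balanced_square_iff:
  assumes [simp]: "X \<in> Obj C" "M \<in> Obj C" "E \<in> Obj C" and
    "x \<in> Ar C E (rdual C M \<Otimes> M)" "y \<in> Ar C E (rdual C (X \<Otimes> M) \<Otimes> (X \<Otimes> M))"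
  shows "FArr (hom_bifun C A) ((ldual C X \<Otimes> X) \<Otimes> M, q) (M, r) (M, r) (M, r)
         (LUnit C M \<cdot> (ev C X \<star> Idm C M)) (Idm C M) \<cdot> x
       = FArr (hom_bifun C A) ((ldual C X \<Otimes> X) \<Otimes> M, q) (ldual C X \<Otimes> (X \<Otimes> M), q') (M, r) (M, r)
         (Assoc C (ldual C X) X M) (Idm C M) \<cdot> hom_balancing C X (X \<Otimes> M, s) (M, r) \<cdot> y
    \<longleftrightarrow> untransposed E y (X \<Otimes> M) = (\<iota> X \<boxtimes> untransposed E x M) \<bullet> asc X M E"
proof -
  let ?x = "TA E x (rdual C M \<Otimes> M)" and ?y = "TA E y (rdual C (X \<Otimes> M) \<Otimes> (X \<Otimes> M))"
  have [simp]: "arrow ?x" "arrow ?y" using assms by (simp_all add: arrow_TA)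
  have "untransposed E y (X \<Otimes> M) = (\<iota> X \<boxtimes> untransposed E x M) \<bullet> asc X M E \<longleftrightarrow>
     (dual_arrow (lun M \<bullet> (evL X \<boxtimes> \<iota> M)) \<boxtimes> \<iota> M) \<bullet> ?x
      = (dual_arrow (asc (ldual C X) X M) \<boxtimes> \<iota> M) \<bullet> balancing X (X \<Otimes> M) M \<bullet> ?y"
    unfolding untransposed_def by (rule balancing_iff[symmetric]) simp_all
  also have "\<dots> \<longleftrightarrow> FArr (hom_bifun C A) ((ldual C X \<Otimes> X) \<Otimes> M, q) (M, r) (M, r) (M, r)
         (LUnit C M \<cdot> (ev C X \<star> Idm C M)) (Idm C M) \<cdot> x
       = FArr (hom_bifun C A) ((ldual C X \<Otimes> X) \<Otimes> M, q) (ldual C X \<Otimes> (X \<Otimes> M), q') (M, r) (M, r)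
         (Assoc C (ldual C X) X M) (Idm C M) \<cdot> hom_balancing C X (X \<Otimes> M, s) (M, r) \<cdot> y"
    by (simp add: hom_bifun_def hom_balancing_def balancing_def phi'_def double_dual_raw[symmetric]
        cmp_def tns_def ident_def asc_def asc'_def lun_def evL_def dual_arrow_raw[symmetric])
  finally show ?thesis by blast
qed

text \<open>
  Transformations of module functors from \<open>- \<otimes>\<^sub>A E\<close> to the identity, for a bimodule \<open>E\<close> with actions \<open>l\<close>
  and \<open>q\<close>, described without the quotient \<open>M \<otimes>\<^sub>A E\<close>: each component is defined on \<open>M \<otimes> E\<close> and
  identifies the two actions of \<open>A\<close> on \<open>M \<otimes> A \<otimes> E\<close>.
\<close>

definition compatible where
  "compatible E l q t \<longleftrightarrow>
     (\<forall>M r. right_action C A M r \<longrightarrow>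
        t (M, r) \<bullet> (\<iota> M \<boxtimes> TA (a \<Otimes> E) l E) = t (M, r) \<bullet> (act M r \<boxtimes> \<iota> E) \<bullet> asc' M a E \<and>
        t (M, r) \<bullet> (\<iota> M \<boxtimes> TA (E \<Otimes> a) q E) = act M r \<bullet> (t (M, r) \<boxtimes> \<iota> a) \<bullet> asc' M E a) \<and>
     (\<forall>M r N s. right_action C A M r \<longrightarrow> right_action C A N s \<longrightarrow>
        (\<forall>f \<in> Ar C M N. f \<cdot> r = s \<cdot> (f \<star> Idm C a) \<longrightarrow>
           TA M f N \<bullet> t (M, r) = t (N, s) \<bullet> (TA M f N \<boxtimes> \<iota> E))) \<and>
     (\<forall>X \<in> Obj C. \<forall>M r. right_action C A M r \<longrightarrow>
        t (X \<Otimes> M, (Idm C X \<star> r) \<cdot> Assoc C X M a) = (\<iota> X \<boxtimes> t (M, r)) \<bullet> asc X M E)"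

lemma bimod_obj_type:
  assumes "(E, l, q) \<in> Obj (bimod_cat C A)"
  shows "E \<in> Obj C" "arrow (TA (a \<Otimes> E) l E)" "arrow (TA (E \<Otimes> a) q E)"
  using assms by (auto simp: bimod_cat_def left_action_def right_action_def arrow_TA)

abbreviation "rmod \<equiv> rmod_cat C A"
abbreviation "bimod \<equiv> bimod_cat C A"
abbreviation "hom_fun \<equiv> hom_bifun C A"

lemma rmod_simps:
  "(M, r) \<in> Obj rmod \<longleftrightarrow> right_action C A M r"
  "f \<in> Ar rmod (M, r) (N, s) \<longleftrightarrow> f \<in> Ar C M N \<and> f \<cdot> r = s \<cdot> (f \<star> Idm C a)"
  "Idm rmod (M, r) = Idm C M"
  "Comp rmod = Comp C"
  "ActObj rmod X (M, r) = (X \<Otimes> M, (Idm C X \<star> r) \<cdot> Assoc C X M a)"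
  "ActArr rmod = TArr C" "MAssoc rmod X Y (M, r) = Assoc C X Y M" "MUnit rmod (M, r) = LUnit C M"
  by (simp_all add: rmod_cat_def)

lemma dinatural_iff:
  "dinatural rmod bimod hom_fun P \<xi> \<longleftrightarrow>
     (\<forall>M r. right_action C A M r \<longrightarrow> \<xi> (M, r) \<in> Ar bimod P (hom_bimod C A (M, r) (M, r))) \<and>
     (\<forall>M r N s. right_action C A M r \<longrightarrow> right_action C A N s \<longrightarrow>
        (\<forall>f \<in> Ar C M N. f \<cdot> r = s \<cdot> (f \<star> Idm C a) \<longrightarrow>
           FArr hom_fun (M, r) (M, r) (M, r) (N, s) (Idm C M) f \<cdot> \<xi> (M, r)
         = FArr hom_fun (M, r) (N, s) (N, s) (N, s) f (Idm C N) \<cdot> \<xi> (N, s)))"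
proof -
  have "FObj hom_fun = hom_bimod C A" "Comp bimod = Comp C"
    by (simp_all add: hom_bifun_def bimod_cat_def)
  then show ?thesis
    unfolding dinatural_def Ball_def split_paired_All rmod_simps by auto
qed

lemma balanced_iff:
  "balanced C rmod bimod hom_fun (hom_balancing C) \<xi> \<longleftrightarrow>
     (\<forall>X \<in> Obj C. \<forall>M r. right_action C A M r \<longrightarrow>
        FArr hom_fun ((ldual C X \<Otimes> X) \<Otimes> M, (Idm C (ldual C X \<Otimes> X) \<star> r) \<cdot> Assoc C (ldual C X \<Otimes> X) M a)
          (M, r) (M, r) (M, r) (LUnit C M \<cdot> (ev C X \<star> Idm C M)) (Idm C M) \<cdot> \<xi> (M, r)
      = FArr hom_fun ((ldual C X \<Otimes> X) \<Otimes> M, (Idm C (ldual C X \<Otimes> X) \<star> r) \<cdot> Assoc C (ldual C X \<Otimes> X) M a)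
          (ldual C X \<Otimes> (X \<Otimes> M), (Idm C (ldual C X) \<star> ((Idm C X \<star> r) \<cdot> Assoc C X M a)) \<cdot> Assoc C (ldual C X) (X \<Otimes> M) a)
          (M, r) (M, r) (Assoc C (ldual C X) X M) (Idm C M)
        \<cdot> hom_balancing C X (X \<Otimes> M, (Idm C X \<star> r) \<cdot> Assoc C X M a) (M, r)
        \<cdot> \<xi> (X \<Otimes> M, (Idm C X \<star> r) \<cdot> Assoc C X M a))"
proof -
  have "Comp bimod = Comp C" by (simp add: bimod_cat_def)
  then show ?thesis
    unfolding balanced_def Ball_def split_paired_All Let_def rmod_simps by auto
qed

text \<open>
  If some component is not an arrow from \<open>E\<close> to \<open>*M \<otimes> M\<close>, neither side holds. Otherwise the conditions
  correspond one by one under transposition.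
\<close>

lemma cone_iff:
  assumes "(E, l, q) \<in> Obj bimod"
  shows "dinatural rmod bimod hom_fun (E, l, q) \<xi> \<and> balanced C rmod bimod hom_fun (hom_balancing C) \<xi> \<longleftrightarrow>
     (\<forall>M r. right_action C A M r \<longrightarrow> \<xi> (M, r) \<in> Ar C E (rdual C M \<Otimes> M)) \<and>
     compatible E l q (\<lambda>(M, r). untransposed E (\<xi> (M, r)) M)"
proof (cases "\<forall>M r. right_action C A M r \<longrightarrow> \<xi> (M, r) \<in> Ar C E (rdual C M \<Otimes> M)")
  case True
  note E [simp] = bimod_obj_type[OF assms]
  have M [simp]: "M \<in> Obj C" if "right_action C A M r" for M r
    using that by (simp add: right_action_def)
  have "dinatural rmod bimod hom_fun (E, l, q) \<xi> \<longleftrightarrow>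
     (\<forall>M r. right_action C A M r \<longrightarrow>
        untransposed E (\<xi> (M, r)) M \<bullet> (\<iota> M \<boxtimes> TA (a \<Otimes> E) l E) = untransposed E (\<xi> (M, r)) M \<bullet> (act M r \<boxtimes> \<iota> E) \<bullet> asc' M a E \<and>
        untransposed E (\<xi> (M, r)) M \<bullet> (\<iota> M \<boxtimes> TA (E \<Otimes> a) q E) = act M r \<bullet> (untransposed E (\<xi> (M, r)) M \<boxtimes> \<iota> a) \<bullet> asc' M E a) \<and>
     (\<forall>M r N s. right_action C A M r \<longrightarrow> right_action C A N s \<longrightarrow>
        (\<forall>f \<in> Ar C M N. f \<cdot> r = s \<cdot> (f \<star> Idm C a) \<longrightarrow>
           TA M f N \<bullet> untransposed E (\<xi> (M, r)) M = untransposed E (\<xi> (N, s)) N \<bullet> (TA M f N \<boxtimes> \<iota> E)))"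
    unfolding dinatural_iff
    using True by (intro arg_cong2[where f = "(\<and>)"] all_cong1 imp_cong ball_cong refl
      hom_bimod_arrow_iff dinatural_square_iff E) (auto intro: M)
  moreover have "balanced C rmod bimod hom_fun (hom_balancing C) \<xi> \<longleftrightarrow>
     (\<forall>X \<in> Obj C. \<forall>M r. right_action C A M r \<longrightarrow>
       untransposed E (\<xi> (X \<Otimes> M, (Idm C X \<star> r) \<cdot> Assoc C X M a)) (X \<Otimes> M) = (\<iota> X \<boxtimes> untransposed E (\<xi> (M, r)) M) \<bullet> asc X M E)"
    unfolding balanced_iff
    using True right_action_tensor by (intro all_cong1 imp_cong ball_cong refl balanced_square_iff E) (auto intro: M)
  ultimately show ?thesis
    using True unfolding compatible_def by simp
next
  case False
  have "Ar bimod (E, l, q) (hom_bimod C A (M, r) (M, r)) \<subseteq> Ar C E (rdual C M \<Otimes> M)" for M r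
    by (auto simp: bimod_cat_def hom_bimod_def)
  then show ?thesis using False unfolding dinatural_iff by blast
qed

text \<open>
  For the regular bimodule, the actions themselves form such a transformation: they are the isomorphisms
  \<open>M \<otimes>\<^sub>A A \<cong> M\<close>.
\<close>

lemma compatible_regular: "compatible a (AMult A) (AMult A) (\<lambda>(M, r). act M r)"
proof -
  have [simp]: "TA (a \<Otimes> a) (AMult A) a = \<mu>" by (simp add: \<mu>_def)
  have "act M r \<bullet> (\<iota> M \<boxtimes> \<mu>) = act M r \<bullet> (act M r \<boxtimes> \<iota> a) \<bullet> asc' M a a" if "right_action C A M r" for M r
  proof -
    have [simp]: "M \<in> Obj C" "arrow (act M r)"
      and assoc: "act M r \<bullet> (act M r \<boxtimes> \<iota> a) = act M r \<bullet> (\<iota> M \<boxtimes> \<mu>) \<bullet> asc M a a"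
      using that by (auto simp: right_action_iff)
    show ?thesis by (simp add: assoc[THEN reassoc])
  qed
  moreover have "TA M f N \<bullet> act M r = act N s \<bullet> (TA M f N \<boxtimes> \<iota> a)" if "f \<cdot> r = s \<cdot> (f \<star> Idm C a)" for M r N s f
    using that by (simp add: act_def cmp_def tns_def ident_def)
  ultimately show ?thesis
    unfolding compatible_def by (simp add: act_tensor)
qed

end

section \<open>Factorisation through the algebra\<close>

locale compatible_transformation = algebra_in_category k C A
  for k :: "'k ring" and C :: "('k, 'o, 'm, 'z) tensor_cat_scheme" (structure)
    and A :: "('o, 'm) alg" +
  fixes E :: 'o and l q :: 'm and t :: "'o \<times> 'm \<Rightarrow> ('o, 'm) tarr"
  assumes E: "(E, l, q) \<in> Obj bimod" and compatible: "compatible E l q t"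
    and t_type: "\<And>M r. right_action C A M r \<Longrightarrow> arrow (t (M, r)) \<and> src (t (M, r)) = M \<Otimes> E \<and> tgt (t (M, r)) = M"
begin

definition "t\<^sub>A = t (a, AMult A)"
definition "factor = t\<^sub>A \<bullet> (\<eta> \<boxtimes> \<iota> E) \<bullet> lun' E"
definition "lE = TA (a \<Otimes> E) l E"
definition "rE = TA (E \<Otimes> a) q E"

lemma transformation_simps [simp]: "E \<in> Obj C" "arrow t\<^sub>A" "src t\<^sub>A = a \<Otimes> E" "tgt t\<^sub>A = a"
  "arrow lE" "src lE = a \<Otimes> E" "tgt lE = E" "arrow rE" "src rE = E \<Otimes> a" "tgt rE = E"
  using bimod_obj_type[OF E] t_type[OF right_action_regular]
  by (simp_all add: t\<^sub>A_def lE_def rE_def)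

lemma factor_type [simp]: "arrow factor" "src factor = E" "tgt factor = a"
  by (simp_all add: factor_def)

lemma t_regular_left: "t\<^sub>A \<bullet> (\<iota> a \<boxtimes> lE) = t\<^sub>A \<bullet> (\<mu> \<boxtimes> \<iota> E) \<bullet> asc' a a E"
  and t_regular_right: "t\<^sub>A \<bullet> (\<iota> a \<boxtimes> rE) = \<mu> \<bullet> (t\<^sub>A \<boxtimes> \<iota> a) \<bullet> asc' a E a"
  using compatible right_action_regular unfolding compatible_def t\<^sub>A_def lE_def rE_def act_regular[symmetric]
  by blast+

text \<open>
  The action \<open>M \<otimes> A \<rightarrow> M\<close> is a map from \<open>M \<rhd> A\<close> to \<open>M\<close>, so naturality along it and compatibility with
  \<open>M \<rhd> -\<close> express \<open>t\<^sub>M (\<rho> \<otimes> E)\<close> by \<open>t\<^sub>A\<close>; the unit of \<open>A\<close> splits \<open>\<rho>\<close>.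
\<close>

lemma t_factor:
  assumes ra: "right_action C A M r"
  shows "t (M, r) = act M r \<bullet> (\<iota> M \<boxtimes> factor)"
proof -
  let ?r = "act M r" and ?t = "t (M, r)" and ?f = "t (M \<Otimes> a, (Idm C M \<star> AMult A) \<cdot> Assoc C M a a)"
  have [simp]: "M \<in> Obj C" "arrow ?r" and unit: "?r \<bullet> (\<iota> M \<boxtimes> \<eta>) = run M"
    using ra by (simp_all add: right_action_iff)
  have [simp]: "arrow ?t" "src ?t = M \<Otimes> E" "tgt ?t = M" using t_type[OF ra] by auto
  \<comment> \<open>The module \<open>M \<rhd> A\<close>, whose underlying object is \<open>M \<otimes> a\<close>.\<close>
  have free: "right_action C A (M \<Otimes> a) ((Idm C M \<star> AMult A) \<cdot> Assoc C M a a)"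
    by (intro right_action_tensor right_action_regular) simp
  have "?f = (\<iota> M \<boxtimes> t\<^sub>A) \<bullet> asc M a E"
    using compatible right_action_regular unfolding compatible_def t\<^sub>A_def by simp
  moreover have "?r \<bullet> ?f = ?t \<bullet> (?r \<boxtimes> \<iota> E)"
  proof -
    \<comment> \<open>Associativity of the action says that it is a map of modules from \<open>M \<rhd> A\<close> to \<open>M\<close>.\<close>
    have "r \<cdot> ((Idm C M \<star> AMult A) \<cdot> Assoc C M a a) = r \<cdot> (r \<star> Idm C a)" "r \<in> Ar C (M \<Otimes> a) M"
      using ra by (simp_all add: right_action_def)
    then show ?thesis
      using compatible free ra unfolding compatible_def act_def by blast
  qed
  ultimately have nat: "?r \<bullet> (\<iota> M \<boxtimes> t\<^sub>A) \<bullet> asc M a E = ?t \<bullet> (?r \<boxtimes> \<iota> E)" by simp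
  have "?r \<bullet> (\<iota> M \<boxtimes> factor) = ?r \<bullet> (\<iota> M \<boxtimes> t\<^sub>A) \<bullet> (\<iota> M \<boxtimes> (\<eta> \<boxtimes> \<iota> E)) \<bullet> (\<iota> M \<boxtimes> lun' E)"
    by (simp add: factor_def interchange)
  also have "\<dots> = (?r \<bullet> (\<iota> M \<boxtimes> t\<^sub>A) \<bullet> asc M a E) \<bullet> asc' M a E \<bullet> (\<iota> M \<boxtimes> (\<eta> \<boxtimes> \<iota> E)) \<bullet> (\<iota> M \<boxtimes> lun' E)"
    by simp
  also have "\<dots> = ?t \<bullet> (?r \<boxtimes> \<iota> E) \<bullet> asc' M a E \<bullet> (\<iota> M \<boxtimes> (\<eta> \<boxtimes> \<iota> E)) \<bullet> (\<iota> M \<boxtimes> lun' E)"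
    unfolding nat by simp
  also have "\<dots> = ?t \<bullet> (?r \<boxtimes> \<iota> E) \<bullet> ((\<iota> M \<boxtimes> \<eta>) \<boxtimes> \<iota> E) \<bullet> (run' M \<boxtimes> \<iota> E)"
    by (simp add: asc'_nat_reassoc triangle')
  also have "\<dots> = ?t \<bullet> ((?r \<bullet> (\<iota> M \<boxtimes> \<eta>)) \<boxtimes> \<iota> E) \<bullet> (run' M \<boxtimes> \<iota> E)"
    by (simp add: interchange_reassoc)
  also have "\<dots> = ?t"
    unfolding unit by (simp add: interchange)
  finally show ?thesis by simp
qed

lemma factor_right: "factor \<bullet> rE = \<mu> \<bullet> (factor \<boxtimes> \<iota> a)"
proof -
  have "factor \<bullet> rE = t\<^sub>A \<bullet> (\<iota> a \<boxtimes> rE) \<bullet> (\<eta> \<boxtimes> \<iota> (E \<Otimes> a)) \<bullet> lun' (E \<Otimes> a)"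
    by (simp add: factor_def lun'_nat interchange_reassoc)
  also have "\<dots> = \<mu> \<bullet> (t\<^sub>A \<boxtimes> \<iota> a) \<bullet> asc' a E a \<bullet> (\<eta> \<boxtimes> (\<iota> E \<boxtimes> \<iota> a)) \<bullet> lun' (E \<Otimes> a)"
    by (simp add: t_regular_right[THEN reassoc])
  also have "\<dots> = \<mu> \<bullet> (t\<^sub>A \<boxtimes> \<iota> a) \<bullet> ((\<eta> \<boxtimes> \<iota> E) \<boxtimes> \<iota> a) \<bullet> (lun' E \<boxtimes> \<iota> a)"
    by (simp add: asc'_nat_reassoc lun'_tensor del: tns_ident)
  also have "\<dots> = \<mu> \<bullet> (factor \<boxtimes> \<iota> a)"
    by (simp add: factor_def interchange)
  finally show ?thesis .
qed

text \<open>
  Left linearity is less direct than right linearity: both sides equal \<open>t\<^sub>A\<close>, the left-hand side because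
  \<open>t\<^sub>A\<close> is balanced over \<open>A\<close>, the right-hand side by \<open>t_factor\<close> for \<open>M = A\<close>.
\<close>

lemma factor_left: "factor \<bullet> lE = \<mu> \<bullet> (\<iota> a \<boxtimes> factor)"
proof -
  have "factor \<bullet> lE = t\<^sub>A \<bullet> (\<iota> a \<boxtimes> lE) \<bullet> (\<eta> \<boxtimes> \<iota> (a \<Otimes> E)) \<bullet> lun' (a \<Otimes> E)"
    by (simp add: factor_def lun'_nat interchange_reassoc)
  also have "\<dots> = t\<^sub>A \<bullet> (\<mu> \<boxtimes> \<iota> E) \<bullet> asc' a a E \<bullet> (\<eta> \<boxtimes> (\<iota> a \<boxtimes> \<iota> E)) \<bullet> lun' (a \<Otimes> E)"
    by (simp add: t_regular_left[THEN reassoc])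
  also have "\<dots> = t\<^sub>A \<bullet> (\<mu> \<boxtimes> \<iota> E) \<bullet> ((\<eta> \<boxtimes> \<iota> a) \<boxtimes> \<iota> E) \<bullet> (lun' a \<boxtimes> \<iota> E)"
    by (simp add: asc'_nat_reassoc lun'_tensor del: tns_ident)
  also have "\<dots> = t\<^sub>A"
    by (simp add: interchange_reassoc interchange unit_left[THEN reassoc])
  also have "\<dots> = \<mu> \<bullet> (\<iota> a \<boxtimes> factor)"
    using t_factor[OF right_action_regular] by (simp add: t\<^sub>A_def act_regular)
  finally show ?thesis .
qed

lemma factor_unique:
  assumes [simp]: "arrow h" "src h = E" "tgt h = a" and h: "t\<^sub>A = \<mu> \<bullet> (\<iota> a \<boxtimes> h)"
  shows "h = factor"
proof -
  have "factor = \<mu> \<bullet> (\<iota> a \<boxtimes> h) \<bullet> (\<eta> \<boxtimes> \<iota> E) \<bullet> lun' E"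
    unfolding factor_def h by simp
  also have "\<dots> = \<mu> \<bullet> (\<eta> \<boxtimes> \<iota> a) \<bullet> (\<iota> \<I> \<boxtimes> h) \<bullet> lun' E"
    by (simp add: interchange_reassoc)
  also have "\<dots> = h"
    by (simp add: unit_left[THEN reassoc] lun_nat_reassoc)
  finally show ?thesis by simp
qed

end

context algebra_in_category
begin

section \<open>The regular bimodule as module end\<close>

definition "regular_end p = rtranspose C (fst p) a (snd p)"

lemma untransposed_regular_end:
  assumes "right_action C A M r"
  shows "regular_end (M, r) \<in> Ar C a (rdual C M \<Otimes> M)" "untransposed a (regular_end (M, r)) M = act M r"
proof -
  have [simp]: "M \<in> Obj C" "arrow (act M r)" using assms by (auto simp: right_action_iff)
  have eq: "TA a (regular_end (M, r)) (rdual C M \<Otimes> M) = radjunct M a (act M r)"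
    by (simp add: regular_end_def adjunct_raw act_def)
  have "arrow (radjunct M a (act M r))" by simp
  then show "regular_end (M, r) \<in> Ar C a (rdual C M \<Otimes> M)"
    unfolding eq[symmetric] arrow_TA by simp
  show "untransposed a (regular_end (M, r)) M = act M r"
    unfolding untransposed_def eq by (rule untranspose_radjunct) simp_all
qed

lemma regular_obj: "(a, AMult A, AMult A) \<in> Obj bimod"
  using algebra by (simp add: algebra_in_def bimod_cat_def right_action_def left_action_def)

lemma bimod_arrow_iff:
  "h \<in> Ar bimod (E, l, q) (E', l', q') \<longleftrightarrow> h \<in> Ar C E E' \<and>
    TA E h E' \<bullet> TA (a \<Otimes> E) l E = TA (a \<Otimes> E') l' E' \<bullet> (\<iota> a \<boxtimes> TA E h E') \<and>
    TA E h E' \<bullet> TA (E \<Otimes> a) q E = TA (E' \<Otimes> a) q' E' \<bullet> (TA E h E' \<boxtimes> \<iota> a)"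
  by (simp add: bimod_cat_def cmp_def tns_def ident_def)

lemma regular_end_factor:
  assumes "right_action C A M r" "E \<in> Obj C" "h \<in> Ar C E a" "x \<in> Ar C E (rdual C M \<Otimes> M)"
  shows "x = regular_end (M, r) \<cdot> h \<longleftrightarrow> untransposed E x M = act M r \<bullet> (\<iota> M \<boxtimes> TA E h a)"
proof -
  let ?x = "TA E x (rdual C M \<Otimes> M)" and ?p = "TA a (regular_end (M, r)) (rdual C M \<Otimes> M)" and ?h = "TA E h a"
  have [simp]: "M \<in> Obj C" "arrow ?x" "arrow ?p" "arrow ?h"
    using assms untransposed_regular_end[OF assms(1)] by (auto simp: right_action_def arrow_TA)
  have "x = regular_end (M, r) \<cdot> h \<longleftrightarrow> ?x = ?p \<bullet> ?h" by (simp add: cmp_def)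
  also have "\<dots> \<longleftrightarrow> untranspose M M ?x = untranspose M M (?p \<bullet> ?h)"
    using untranspose_inject[of M M ?x "?p \<bullet> ?h"] assms(2) by auto
  also have "untranspose M M (?p \<bullet> ?h) = act M r \<bullet> (\<iota> M \<boxtimes> ?h)"
    using untransposed_regular_end[OF assms(1)] by (simp add: untranspose_comp untransposed_def)
  finally show ?thesis by (simp add: untransposed_def)
qed

lemma regular_bimod_module_end:
  "is_module_end C rmod bimod hom_fun (hom_balancing C) (regular_bimod A) regular_end"
  unfolding is_module_end_def
proof (intro conjI ballI allI impI)
  show "regular_bimod A \<in> Obj bimod" by (simp add: regular_obj regular_bimod_def)
  have "compatible a (AMult A) (AMult A) (\<lambda>(M, r). untransposed a (regular_end (M, r)) M)"
    using compatible_regular right_action_tensor unfolding compatible_def by (simp add: untransposed_regular_end)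
  then show "dinatural rmod bimod hom_fun (regular_bimod A) regular_end"
    and "balanced C rmod bimod hom_fun (hom_balancing C) regular_end"
    using cone_iff[OF regular_obj, of regular_end] untransposed_regular_end unfolding regular_bimod_def by blast+
next
  fix P \<xi>
  assume P: "P \<in> Obj bimod"
    and cone: "dinatural rmod bimod hom_fun P \<xi> \<and> balanced C rmod bimod hom_fun (hom_balancing C) \<xi>"
  obtain E l q where P_eq: "P = (E, l, q)" by (cases P)
  note E = P[unfolded P_eq]
  let ?t = "\<lambda>(M, r). untransposed E (\<xi> (M, r)) M"
  have \<xi>: "\<xi> (M, r) \<in> Ar C E (rdual C M \<Otimes> M)" if "right_action C A M r" for M r
    using cone cone_iff[OF E, of \<xi>] that unfolding P_eq by blast
  interpret compatible_transformation k C A E l q ?t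
  proof
    show "compatible E l q ?t" using cone cone_iff[OF E] unfolding P_eq by blast
    show "arrow (?t (M, r)) \<and> src (?t (M, r)) = M \<Otimes> E \<and> tgt (?t (M, r)) = M"
      if "right_action C A M r" for M r
      using \<xi>[OF that] bimod_obj_type[OF E] that by (simp add: right_action_def)
  qed (fact E)
  define h where "h = raw factor"
  have h: "TA E h a = factor"
    using factor_type by (cases factor) (simp add: h_def)
  have h_arr: "h \<in> Ar C E a"
    using factor_type(1) unfolding h[symmetric] arrow_TA by simp
  show "\<exists>!h. h \<in> Ar bimod P (regular_bimod A) \<and> (\<forall>M \<in> Obj rmod. \<xi> M = regular_end M \<cdot>\<^bsub>bimod\<^esub> h)"
  proof (rule ex1I[of _ h], intro conjI ballI)
    show "h \<in> Ar bimod P (regular_bimod A)"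
      unfolding P_eq regular_bimod_def bimod_arrow_iff h
      using h_arr factor_left factor_right by (simp add: lE_def rE_def \<mu>_def)
    fix p assume "p \<in> Obj rmod"
    then obtain M r where p: "p = (M, r)" "right_action C A M r" by (cases p) (auto simp: rmod_simps)
    show "\<xi> p = regular_end p \<cdot>\<^bsub>bimod\<^esub> h"
      using regular_end_factor[OF p(2) _ h_arr \<xi>[OF p(2)]] t_factor[OF p(2)]
      by (simp add: p(1) h bimod_cat_def)
  next
    fix g assume g: "g \<in> Ar bimod P (regular_bimod A) \<and> (\<forall>M \<in> Obj rmod. \<xi> M = regular_end M \<cdot>\<^bsub>bimod\<^esub> g)"
    then have g_arr: "g \<in> Ar C E a"
      unfolding P_eq regular_bimod_def using bimod_arrow_iff by blast
    have "\<xi> (a, AMult A) = regular_end (a, AMult A) \<cdot> g"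
      using g right_action_regular by (simp add: rmod_simps bimod_cat_def)
    then have "t\<^sub>A = \<mu> \<bullet> (\<iota> a \<boxtimes> TA E g a)"
      using regular_end_factor[OF right_action_regular _ g_arr \<xi>[OF right_action_regular]]
      by (simp add: t\<^sub>A_def act_regular)
    then have "TA E g a = factor"
      using g_arr by (intro factor_unique) (simp_all add: arrow_TA)
    then show "g = h" by (simp add: h[symmetric])
  qed
qed

lemma bimod_comp:
  assumes "P \<in> Obj bimod" "Q \<in> Obj bimod" "R \<in> Obj bimod" "f \<in> Ar bimod P Q" "g \<in> Ar bimod Q R"
  shows "g \<cdot>\<^bsub>bimod\<^esub> f \<in> Ar bimod P R"
proof -
  obtain X l q Y l' q' Z l'' q'' where eq: "P = (X, l, q)" "Q = (Y, l', q')" "R = (Z, l'', q'')"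
    by (metis prod_cases3)
  note [simp] = assms(1)[unfolded eq, THEN bimod_obj_type(1)] assms(1)[unfolded eq, THEN bimod_obj_type(2)]
    assms(1)[unfolded eq, THEN bimod_obj_type(3)] assms(2)[unfolded eq, THEN bimod_obj_type(1)]
    assms(2)[unfolded eq, THEN bimod_obj_type(2)] assms(2)[unfolded eq, THEN bimod_obj_type(3)]
    assms(3)[unfolded eq, THEN bimod_obj_type(1)] assms(3)[unfolded eq, THEN bimod_obj_type(2)]
    assms(3)[unfolded eq, THEN bimod_obj_type(3)]
  have f: "f \<in> Ar C X Y" "TA X f Y \<bullet> TA (a \<Otimes> X) l X = TA (a \<Otimes> Y) l' Y \<bullet> (\<iota> a \<boxtimes> TA X f Y)"
      "TA X f Y \<bullet> TA (X \<Otimes> a) q X = TA (Y \<Otimes> a) q' Y \<bullet> (TA X f Y \<boxtimes> \<iota> a)"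
    and g: "g \<in> Ar C Y Z" "TA Y g Z \<bullet> TA (a \<Otimes> Y) l' Y = TA (a \<Otimes> Z) l'' Z \<bullet> (\<iota> a \<boxtimes> TA Y g Z)"
      "TA Y g Z \<bullet> TA (Y \<Otimes> a) q' Y = TA (Z \<Otimes> a) q'' Z \<bullet> (TA Y g Z \<boxtimes> \<iota> a)"
    using assms(4,5) unfolding eq bimod_arrow_iff by auto
  have [simp]: "arrow (TA X f Y)" "arrow (TA Y g Z)"
    using f(1) g(1) by (simp_all add: arrow_TA)
  have gf: "TA X (g \<cdot> f) Z = TA Y g Z \<bullet> TA X f Y" by (simp add: cmp_def)
  have "g \<cdot> f \<in> Ar C X Z" using f(1) g(1) using comp_arr[of X Y Z f g] by simp
  then have "g \<cdot> f \<in> Ar bimod P R"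
    unfolding eq bimod_arrow_iff gf by (simp add: f(2,3) g(2,3)[THEN reassoc] interchange)
  then show ?thesis by (simp add: bimod_cat_def)
qed

lemma bimod_ident: "P \<in> Obj bimod \<Longrightarrow> Idm bimod P \<in> Ar bimod P P"
proof (cases P)
  case (fields E l q)
  assume "P \<in> Obj bimod"
  note [simp] = bimod_obj_type[OF this[unfolded fields]]
  have "Idm C E \<in> Ar C E E" by (simp add: id_arr)
  moreover have "TA E (Idm C E) E = \<iota> E" by (simp add: ident_def)
  moreover have "Idm bimod P = Idm C E" by (simp add: fields bimod_cat_def)
  ultimately show ?thesis unfolding fields bimod_arrow_iff by simp
qed

text \<open>
  Each of the two module ends factors through the other. The composites of the comparison arrows are endomorphisms
  that are compatible with the cone, as the identities are, so by uniqueness they agree with them.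
\<close>

lemma module_end_unique:
  assumes "is_module_end C rmod bimod hom_fun (hom_balancing C) P \<pi>"
    and "is_module_end C rmod bimod hom_fun (hom_balancing C) Q \<rho>"
  shows "isomorphic bimod P Q"
proof -
  let ?end = "is_module_end C rmod bimod hom_fun (hom_balancing C)"
  have inverse: "g \<cdot>\<^bsub>bimod\<^esub> f = Idm bimod P"
    if ends: "?end P \<pi>" "?end Q \<rho>" and f: "f \<in> Ar bimod P Q" "\<forall>M \<in> Obj rmod. \<pi> M = \<rho> M \<cdot>\<^bsub>bimod\<^esub> f"
      and g: "g \<in> Ar bimod Q P" "\<forall>M \<in> Obj rmod. \<rho> M = \<pi> M \<cdot>\<^bsub>bimod\<^esub> g" for P Q \<pi> \<rho> f g
  proof -
    have P: "P \<in> Obj bimod" and Q: "Q \<in> Obj bimod" and cone: "dinatural rmod bimod hom_fun P \<pi>"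
        "balanced C rmod bimod hom_fun (hom_balancing C) \<pi>"
      using ends unfolding is_module_end_def by auto
    then have unique: "\<exists>!h. h \<in> Ar bimod P P \<and> (\<forall>M \<in> Obj rmod. \<pi> M = \<pi> M \<cdot>\<^bsub>bimod\<^esub> h)"
      using ends(1) unfolding is_module_end_def by blast
    obtain X l q Y l' q' where eq: "P = (X, l, q)" "Q = (Y, l', q')" by (metis prod_cases3)
    have obj: "X \<in> Obj C" "Y \<in> Obj C" using P Q bimod_obj_type(1) unfolding eq by blast+
    have arr: "f \<in> Ar C X Y" "g \<in> Ar C Y X" using f(1) g(1) unfolding eq bimod_arrow_iff by auto
    have "\<pi> p = \<pi> p \<cdot>\<^bsub>bimod\<^esub> (g \<cdot>\<^bsub>bimod\<^esub> f)" "\<pi> p = \<pi> p \<cdot>\<^bsub>bimod\<^esub> Idm bimod P" if p: "p \<in> Obj rmod" for p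
    proof -
      obtain M r where M: "p = (M, r)" "right_action C A M r" using p by (cases p) (auto simp: rmod_simps)
      have "\<pi> p \<in> Ar C X (rdual C M \<Otimes> M)" "rdual C M \<Otimes> M \<in> Obj C"
        using cone cone_iff[OF P[unfolded eq], of \<pi>] M unfolding eq by (auto simp: right_action_def)
      then have "(\<pi> p \<cdot> g) \<cdot> f = \<pi> p \<cdot> (g \<cdot> f)" "\<pi> p \<cdot> Idm C X = \<pi> p"
        using obj arr comp_assoc[of X Y X "rdual C M \<Otimes> M" f g "\<pi> p"] comp_id[of X "rdual C M \<Otimes> M" "\<pi> p"]
        by blast+
      moreover have "\<pi> p = \<rho> p \<cdot> f" "\<rho> p = \<pi> p \<cdot> g" using f(2) g(2) p by (simp_all add: bimod_cat_def)
      moreover have "Comp bimod = Comp C" "Idm bimod P = Idm C X" by (simp_all add: eq bimod_cat_def)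
      ultimately show "\<pi> p = \<pi> p \<cdot>\<^bsub>bimod\<^esub> (g \<cdot>\<^bsub>bimod\<^esub> f)" "\<pi> p = \<pi> p \<cdot>\<^bsub>bimod\<^esub> Idm bimod P"
        by metis+
    qed
    moreover have "g \<cdot>\<^bsub>bimod\<^esub> f \<in> Ar bimod P P" "Idm bimod P \<in> Ar bimod P P"
      using bimod_comp[OF P Q P f(1) g(1)] bimod_ident[OF P] by auto
    ultimately show ?thesis using unique by blast
  qed
  have "P \<in> Obj bimod \<and> dinatural rmod bimod hom_fun P \<pi> \<and> balanced C rmod bimod hom_fun (hom_balancing C) \<pi>"
    "Q \<in> Obj bimod \<and> dinatural rmod bimod hom_fun Q \<rho> \<and> balanced C rmod bimod hom_fun (hom_balancing C) \<rho>"
    using assms unfolding is_module_end_def by blast+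
  then obtain f g where f: "f \<in> Ar bimod P Q" "\<forall>M \<in> Obj rmod. \<pi> M = \<rho> M \<cdot>\<^bsub>bimod\<^esub> f"
    and g: "g \<in> Ar bimod Q P" "\<forall>M \<in> Obj rmod. \<rho> M = \<pi> M \<cdot>\<^bsub>bimod\<^esub> g"
    using assms unfolding is_module_end_def by meson
  have "inverse_arrows bimod P Q f g"
    unfolding inverse_arrows_def
    using inverse[OF assms f g] inverse[OF assms(2,1) g f] f(1) g(1) by blast
  then show ?thesis by (auto simp: isomorphic_def iso_arrow_def)
qed

end

theorem corollary4p6:
  fixes k :: "'k ring" and C :: "('k, 'o, 'm) tensor_cat" and A :: "('o, 'm) alg"
  assumes "tensor_category k C"
    and "algebra_in C A"
    and "exact_module_category C (rmod_cat C A)"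
  shows "(\<exists>E \<pi>. is_module_end C (rmod_cat C A) (bimod_cat C A) (hom_bifun C A) (hom_balancing C) E \<pi>)
    \<and> (\<forall>E \<pi>. is_module_end C (rmod_cat C A) (bimod_cat C A) (hom_bifun C A) (hom_balancing C) E \<pi>
         \<longrightarrow> isomorphic (bimod_cat C A) (regular_bimod A) E)"
proof -
  interpret algebra_in_category k C A
    by (intro algebra_in_category.intro algebra_in_category_axioms.intro assms)
  show ?thesis
    using regular_bimod_module_end module_end_unique by blast
qed

end
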